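(* Let $f \in \mathbb{C}[x_1,\dots,x_n]_d$ with $\underline{\mathsf{WR}}(f) = r$. Then $\mathsf{WR}(f) \le M(r)\cdot d$.
   Context: $\mathsf{WR}(f)$ is the Waring rank: the smallest $s$ with $f=\sum_{k=1}^s\ell_k^d$ for linear forms $\ell_k$. $\underline{\mathsf{WR}}(f)$ is the border Waring rank: the smallest $s$ with $f=\lim_{\epsilon\to0}\sum_{k=1}^s\ell_k(\epsilon)^d$ for linear forms $\ell_k(\epsilon)$ with coefficients rational in $\epsilon$. $\mathsf{maxR}(n,e)=\max\{\mathsf{WR}(h)\mid h\in\mathbb{C}[x_1,\dots,x_n]_e\}$. The partition-maxrank function is $M(r) = \max_{r_1+\dots+r_m = r}\sum_{k=1}^m \mathsf{maxR}(r_k, r_k-1)$, the maximum over all partitions of $r$ into positive integers $r_1,\dots,r_m$.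
   Formalization: The degree d is assumed to be at least 1 (for d = 0 and f = 1 the bound would be 0 while WR(f) = 1), and maxR(n,0) is set to 1 by convention, since constants such as 1/2 are not sums of 0-th powers and M(r) would otherwise be undefined. *)

theory Defs
  imports "HOL-Analysis.Analysis" "HOL-Computational_Algebra.Polynomial"
begin

text \<open>Points of C^n are functions nat => complex; only coordinates i < n matter.
A form of degree d in n variables is represented by its polynomial function.\<close>

definition lin_form :: "nat \<Rightarrow> (nat \<Rightarrow> complex) \<Rightarrow> (nat \<Rightarrow> complex) \<Rightarrow> complex" where
  "lin_form n a = (\<lambda>x. \<Sum>i<n. a i * x i)"

definition exps :: "nat \<Rightarrow> nat \<Rightarrow> (nat \<Rightarrow> nat) set" where
  "exps n d = {\<alpha>. (\<forall>i\<ge>n. \<alpha> i = 0) \<and> (\<Sum>i<n. \<alpha> i) = d}"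

definition hom_form :: "nat \<Rightarrow> nat \<Rightarrow> ((nat \<Rightarrow> complex) \<Rightarrow> complex) \<Rightarrow> bool" where
  "hom_form n d f \<longleftrightarrow>
     (\<exists>c :: (nat \<Rightarrow> nat) \<Rightarrow> complex.
        f = (\<lambda>x. \<Sum>\<alpha>\<in>exps n d. c \<alpha> * (\<Prod>i<n. x i ^ \<alpha> i)))"

definition WR :: "nat \<Rightarrow> nat \<Rightarrow> ((nat \<Rightarrow> complex) \<Rightarrow> complex) \<Rightarrow> nat" where
  "WR n d f = (LEAST s. \<exists>a :: nat \<Rightarrow> nat \<Rightarrow> complex.
                  f = (\<lambda>x. \<Sum>k<s. (lin_form n (a k) x) ^ d))"

definition BWR :: "nat \<Rightarrow> nat \<Rightarrow> ((nat \<Rightarrow> complex) \<Rightarrow> complex) \<Rightarrow> nat" where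
  "BWR n d f = (LEAST s. \<exists>P Q :: nat \<Rightarrow> nat \<Rightarrow> complex poly.
                  (\<forall>k i. Q k i \<noteq> 0) \<and>
                  (\<forall>x. ((\<lambda>\<epsilon>. \<Sum>k<s. (\<Sum>i<n. poly (P k i) \<epsilon> / poly (Q k i) \<epsilon> * x i) ^ d)
                          \<longlongrightarrow> f x) (at 0)))"

text \<open>maxR(n,e); for e = 0 (constants) the convention maxR(n,0) = 1 is used.\<close>
definition maxR :: "nat \<Rightarrow> nat \<Rightarrow> nat" where
  "maxR n e = (if e = 0 then 1 else Max {WR n e h | h. hom_form n e h})"

definition partM :: "nat \<Rightarrow> nat" where
  "partM r = Max {(\<Sum>k<m. maxR (p k) (p k - 1)) | (m::nat) (p::nat \<Rightarrow> nat).
                (\<forall>k<m. p k \<ge> 1) \<and> (\<Sum>k<m. p k) = r}"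

end

theory Submission
  imports Defs
begin

text \<open>Along a sequence tending to 0, \<open>f\<close> is a limit of sums of \<open>r\<close> powers \<open>\<ell>\<^sub>k(m)\<^sup>d\<close>. Scale the
  \<open>\<ell>\<^sub>k(m)\<close> to points \<open>w\<^sub>k(m)\<close> of an affine chart which converge (compactness) and regard the sum as
  the functional \<open>h \<mapsto> \<Sum>\<^sub>k \<lambda>\<^sub>k(m) h(w\<^sub>k(m))\<close> on polynomials. On \<open>r\<close> points every polynomial agrees
  with one of degree at most \<open>r - 1\<close>, with coefficients under control, so if \<open>d \<ge> r - 1\<close> then
  convergence in degree \<open>d\<close> implies convergence in all degrees. Multiplying by a polynomial that is 1
  on the points with a given limit and 0 on the others, each such cluster converges separately. If a
  cluster has \<open>s\<close> points with limit \<open>L\<close>, the product of \<open>s\<close> linear functions, each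
  vanishing at one of its points, is annihilated; hence in the expansion around \<open>L\<close> only the
  terms of order below \<open>s\<close> survive, and the limit is \<open>L\<^bsup>d-s+1\<^esup> g\<close> with \<open>g\<close> of degree
  \<open>s - 1\<close>. As a limit of forms depending on \<open>s\<close> linear forms, \<open>g\<close> depends on \<open>s\<close> variables. So
  \<open>g\<close> is a sum of \<open>maxR s (s - 1)\<close> powers \<open>M\<^bsup>s-1\<^esup>\<close>, and each binary form \<open>L\<^bsup>d-s+1\<^esup> M\<^bsup>s-1\<^esup>\<close> is a
  sum of \<open>d\<close> powers. If \<open>d < r - 1\<close>, then \<open>f\<close> depends on \<open>r\<close> variables and
  \<open>maxR r d \<le> maxR r (r - 1)\<close>, since every form is a derivative.\<close>

subsection \<open>Sums of powers of linear forms\<close>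

text \<open>Since \<open>WR\<close> is a \<open>LEAST\<close>, it carries information only once some
  decomposition is known to exist. Rank bounds therefore travel as this existence statement and are
  converted to \<open>WR\<close> only for \<open>maxR\<close> and in the final theorem.\<close>

definition power_sum :: "nat \<Rightarrow> nat \<Rightarrow> nat \<Rightarrow> ((nat \<Rightarrow> complex) \<Rightarrow> complex) \<Rightarrow> bool" where
  "power_sum n d s f \<longleftrightarrow> (\<exists>a. f = (\<lambda>x. \<Sum>k<s. lin_form n (a k) x ^ d))"

lemma WR_le: "power_sum n d s f \<Longrightarrow> WR n d f \<le> s"
  unfolding WR_def power_sum_def by (rule Least_le)

lemma power_sum_WR: "power_sum n d s f \<Longrightarrow> power_sum n d (WR n d f) f"
  unfolding WR_def power_sum_def by (rule LeastI)

lemma lin_form_commute: "lin_form n a x = lin_form n x a"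
  by (simp add: lin_form_def mult.commute)

lemma lin_form_zero [simp]: "lin_form n (\<lambda>_. 0) x = 0"
  by (simp add: lin_form_def)

lemma lin_form_add: "lin_form n (\<lambda>i. a i + b i) x = lin_form n a x + lin_form n b x"
  by (simp add: lin_form_def sum.distrib algebra_simps)

lemma lin_form_cmult: "lin_form n (\<lambda>i. c * a i) x = c * lin_form n a x"
  by (simp add: lin_form_def sum_distrib_left algebra_simps)

lemma lin_form_diff: "lin_form n (\<lambda>i. a i - b i) x = lin_form n a x - lin_form n b x"
  by (simp add: lin_form_def sum_subtractf algebra_simps)

lemma lin_form_sum: "lin_form n (\<lambda>i. \<Sum>j\<in>A. c j * a j i) x = (\<Sum>j\<in>A. c j * lin_form n (a j) x)"
  unfolding lin_form_def sum_distrib_left sum_distrib_right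
  by (subst sum.swap) (simp add: mult_ac)

lemma lin_form_unit: "i < n \<Longrightarrow> lin_form n (\<lambda>j. if j = i then 1 else 0) x = x i"
  unfolding lin_form_def by (subst sum.remove[of _ i]) (auto intro!: sum.neutral)

lemma power_sum_add:
  assumes "power_sum n d s f" "power_sum n d t g"
  shows "power_sum n d (s + t) (\<lambda>x. f x + g x)"
proof -
  obtain a b where a: "f = (\<lambda>x. \<Sum>k<s. lin_form n (a k) x ^ d)"
    and b: "g = (\<lambda>x. \<Sum>k<t. lin_form n (b k) x ^ d)"
    using assms unfolding power_sum_def by blast
  have "(\<Sum>k<s + t. lin_form n (if k < s then a k else b (k - s)) x ^ d) = f x + g x" for x
  proof -
    have "{..<s + t} = {..<s} \<union> {s..<s + t}" by auto
    then have "(\<Sum>k<s + t. lin_form n (if k < s then a k else b (k - s)) x ^ d) =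
      (\<Sum>k<s. lin_form n (if k < s then a k else b (k - s)) x ^ d) +
      (\<Sum>k=s..<s + t. lin_form n (if k < s then a k else b (k - s)) x ^ d)"
      by (simp add: sum.union_disjoint ivl_disj_int)
    also have "(\<Sum>k=s..<s + t. lin_form n (if k < s then a k else b (k - s)) x ^ d) = g x"
      unfolding b by (rule sum.reindex_bij_witness[of _ "\<lambda>k. k + s" "\<lambda>k. k - s"]) auto
    finally show ?thesis by (simp add: a)
  qed
  then show ?thesis unfolding power_sum_def
    by (intro exI[of _ "\<lambda>k. if k < s then a k else b (k - s)"]) auto
qed

lemma power_sum_zero: "power_sum n d 0 (\<lambda>x. 0)"
  by (simp add: power_sum_def)

lemma power_sum_mono:
  assumes "power_sum n d s f" "s \<le> t" "d \<ge> 1"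
  shows "power_sum n d t f"
proof -
  \<comment> \<open>Padding with powers of the zero form; this uses \<open>d \<ge> 1\<close>, as 0^0
    = 1.\<close>
  have "power_sum n d (t - s) (\<lambda>x. 0)"
    unfolding power_sum_def using assms(3) by (intro exI[of _ "\<lambda>_ _. 0"]) (auto simp: power_0_left)
  from power_sum_add[OF assms(1) this] show ?thesis using assms(2) by simp
qed

lemma power_sum_sum:
  assumes "finite A" "\<And>i. i \<in> A \<Longrightarrow> power_sum n d (s i) (f i)"
  shows "power_sum n d (\<Sum>i\<in>A. s i) (\<lambda>x. \<Sum>i\<in>A. f i x)"
  using assms by (induction A rule: finite_induct) (auto intro: power_sum_zero power_sum_add)

lemma complex_root_exists:
  fixes c :: complex
  assumes "d \<ge> 1"
  obtains z where "z ^ d = c"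
proof (cases "c = 0")
  case True
  then show ?thesis using that[of 0] assms by simp
next
  case False
  have "exp (Ln c / of_nat d) ^ d = c"
    using False assms by (simp add: exp_of_nat_mult[symmetric])
  then show ?thesis using that by blast
qed

lemma power_sum_cmult:
  assumes "power_sum n d s f" "d \<ge> 1"
  shows "power_sum n d s (\<lambda>x. c * f x)"
proof -
  obtain a where a: "f = (\<lambda>x. \<Sum>k<s. lin_form n (a k) x ^ d)"
    using assms unfolding power_sum_def by blast
  obtain z where z: "z ^ d = c" using complex_root_exists[OF assms(2)] .
  show ?thesis unfolding power_sum_def a
    by (intro exI[of _ "\<lambda>k i. z * a k i"])
      (simp add: lin_form_cmult power_mult_distrib z sum_distrib_left)
qed

lemma power_sum_power: "power_sum n d 1 (\<lambda>x. lin_form n a x ^ d)"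
  by (auto simp: power_sum_def)

section \<open>Binary monomials and products of linear forms as sums of powers\<close>

text \<open>Orthogonality of the characters of Z/d, by a geometric sum. The bounds on
  \<open>k\<close> and \<open>b\<close> give |k - b| < d, so congruence modulo \<open>d\<close>
  means equality; with b = 0 or b = d both k = 0 and k = d would survive.\<close>

lemma sum_roots_of_unity_powers:
  fixes k b d :: nat
  assumes "k \<le> d" "0 < b" "b < d"
  shows "(\<Sum>j<d. cis (2 * pi * j / d) ^ k / cis (2 * pi * j / d) ^ b) = (if k = b then of_nat d else 0)"
proof (cases "k = b")
  case True
  then show ?thesis by simp
next
  case False
  define \<omega> where "\<omega> = cis (2 * pi / d)"
  define z where "z = \<omega> ^ k / \<omega> ^ b"
  have w: "cis (2 * pi * j / d) = \<omega> ^ j" for j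
    using Complex.DeMoivre[of "2 * pi / d" j] by (simp add: \<omega>_def mult_ac)
  have wd: "\<omega> ^ d = 1" using assms by (simp add: \<omega>_def Complex.DeMoivre)
  have w0: "\<omega> \<noteq> 0" by (simp add: \<omega>_def)
  have "z \<noteq> 1"
  proof
    assume "z = 1"
    then have "\<omega> ^ k = \<omega> ^ b" by (simp add: z_def w0)
    then have "cis (2 * pi * k / d) = cis (2 * pi * b / d)" by (simp add: w)
    then have "cis (2 * pi * k / d - 2 * pi * b / d) = 1"
      by (simp add: cis_divide[symmetric])
    then have "cos (2 * pi * k / d - 2 * pi * b / d) = 1"
      by (metis cis.simps(1) one_complex.simps(1))
    then obtain m :: int where m: "2 * pi * k / d - 2 * pi * b / d = m * 2 * pi"
      using cos_one_2pi_int by auto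
    then have "2 * pi * (real k - real b) = 2 * pi * (real_of_int m * d)"
      using assms by (simp add: field_simps)
    then have "real k - real b = real_of_int m * d" by simp
    then have eq: "int k - int b = m * int d"
      by (metis (mono_tags, lifting) of_int_diff of_int_eq_iff of_int_mult of_int_of_nat_eq)
    have "\<bar>int k - int b\<bar> < int d" using assms by auto
    then have "\<bar>m\<bar> * int d < 1 * int d" by (simp add: eq abs_mult)
    then have "m = 0" using assms by (simp add: mult_less_cancel_right)
    then show False using eq False by simp
  qed
  have "z ^ d = 1"
    by (simp add: z_def power_divide power_mult[symmetric] mult.commute[of _ d])
       (simp add: power_mult wd w0)
  have "(\<Sum>j<d. cis (2 * pi * j / d) ^ k / cis (2 * pi * j / d) ^ b) = (\<Sum>j<d. z ^ j)"
    unfolding w z_def power_divide power_mult[symmetric] by (simp add: mult.commute)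
  also have "\<dots> = 0" using \<open>z \<noteq> 1\<close> \<open>z ^ d = 1\<close> by (simp add: geometric_sum)
  finally show ?thesis using False by simp
qed

text \<open>The source of the factor \<open>d\<close> in the theorem. A weighted sum of the powers
  (X + w^j Y)^d over the d-th roots of unity filters out one term of the binomial expansion. The
  pure powers, where the filter fails, are a single power padded with zeros. The coefficients do not
  depend on X and Y, so linear forms may be substituted.\<close>

lemma binary_monomial_power_sum:
  assumes "a + b = d" "d \<ge> 1"
  shows "\<exists>p q :: nat \<Rightarrow> complex. \<forall>X Y. X ^ a * Y ^ b = (\<Sum>j<d. (p j * X + q j * Y) ^ d)"
proof -
  consider "b = 0" | "a = 0" | "0 < b" "b < d" using assms by linarith
  then show ?thesis
  proof cases
    case 1
    have "(\<Sum>j<d. ((if j = 0 then 1 else 0) * X + 0 * Y) ^ d) = X ^ d" for X Y :: complex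
      using assms by (subst sum.remove[of _ 0]) (auto intro!: sum.neutral)
    then show ?thesis using 1 assms
      by (intro exI[of _ "\<lambda>j. if j = 0 then 1 else 0"] exI[of _ "\<lambda>_. 0"]) auto
  next
    case 2
    have "(\<Sum>j<d. (0 * X + (if j = 0 then 1 else 0) * Y) ^ d) = Y ^ d" for X Y :: complex
      using assms by (subst sum.remove[of _ 0]) (auto intro!: sum.neutral)
    then show ?thesis using 2 assms
      by (intro exI[of _ "\<lambda>_. 0"] exI[of _ "\<lambda>j. if j = 0 then 1 else 0"]) auto
  next
    case 3
    define w where "w j = cis (2 * pi * j / d)" for j :: nat
    have *: "(\<Sum>j<d. 1 / w j ^ b * (X + w j * Y) ^ d) = of_nat d * of_nat (d choose b) * (X ^ a * Y ^ b)"
      for X Y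
    proof -
      have "(\<Sum>j<d. 1 / w j ^ b * (X + w j * Y) ^ d) =
        (\<Sum>j<d. \<Sum>k\<le>d. of_nat (d choose k) * (w j ^ k / w j ^ b) * (Y ^ k * X ^ (d - k)))"
        by (simp add: add.commute[of X] binomial_ring sum_distrib_left power_mult_distrib
            mult_ac divide_inverse)
      also have "\<dots> = (\<Sum>k\<le>d. of_nat (d choose k) * (\<Sum>j<d. w j ^ k / w j ^ b) * (Y ^ k * X ^ (d - k)))"
        by (subst sum.swap) (simp add: sum_distrib_left sum_distrib_right)
      also have "\<dots> = (\<Sum>k\<le>d. if k = b then of_nat (d choose k) * of_nat d * (Y ^ k * X ^ (d - k)) else 0)"
        using sum_roots_of_unity_powers[OF _ 3] unfolding w_def by (intro sum.cong) auto
      also have "\<dots> = of_nat d * of_nat (d choose b) * (X ^ a * Y ^ b)"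
        using 3 assms(1) by (auto simp: mult_ac)
      finally show ?thesis .
    qed
    define K :: complex where "K = of_nat d * of_nat (d choose b)"
    have "K \<noteq> 0" using 3 by (simp add: K_def)
    \<comment> \<open>A d-th root moves the weight of each summand inside the power.\<close>
    have "\<exists>z. z ^ d = 1 / (K * w j ^ b)" for j
      using complex_root_exists[OF assms(2)] by metis
    then obtain z where z: "\<And>j. z j ^ d = 1 / (K * w j ^ b)" by metis
    have "X ^ a * Y ^ b = (\<Sum>j<d. (z j * X + z j * w j * Y) ^ d)" for X Y
    proof -
      have "(\<Sum>j<d. (z j * X + z j * w j * Y) ^ d) = (\<Sum>j<d. z j ^ d * (X + w j * Y) ^ d)"
        by (intro sum.cong) (simp_all add: power_mult_distrib[symmetric] algebra_simps)
      also have "\<dots> = 1 / K * (\<Sum>j<d. 1 / w j ^ b * (X + w j * Y) ^ d)"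
        by (simp add: z sum_distrib_left)
      also have "\<dots> = X ^ a * Y ^ b" unfolding * using \<open>K \<noteq> 0\<close> by (simp add: K_def)
      finally show ?thesis by simp
    qed
    then show ?thesis by (intro exI[of _ z] exI[of _ "\<lambda>j. z j * w j"]) simp
  qed
qed

lemma power_sum_binary_monomial:
  assumes "a + b = d" "d \<ge> 1"
  shows "power_sum n d d (\<lambda>x. lin_form n u x ^ a * lin_form n v x ^ b)"
proof -
  obtain p q :: "nat \<Rightarrow> complex" where pq: "\<And>X Y. X ^ a * Y ^ b = (\<Sum>j<d. (p j * X + q j * Y) ^ d)"
    using binary_monomial_power_sum[OF assms] by metis
  show ?thesis unfolding power_sum_def pq
    by (intro exI[of _ "\<lambda>j i. p j * u i + q j * v i"]) (simp add: lin_form_add lin_form_cmult)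
qed

text \<open>A form of polarization, obtained by multiplying each power l^e by one more linear form
  through the binary case. It yields finiteness of ranks, and it carries convergence from d-th
  powers over to products of \<open>d\<close> different linear forms.\<close>

lemma power_sum_prod_list:
  "power_sum n (length us) (fact (length us)) (\<lambda>x. prod_list (map (\<lambda>u. lin_form n u x) us))"
proof (induction us)
  case Nil
  show ?case by (simp add: power_sum_def)
next
  case (Cons u us)
  let ?e = "length us"
  obtain a where a: "(\<lambda>x. prod_list (map (\<lambda>u. lin_form n u x) us)) =
      (\<lambda>x. \<Sum>k<fact ?e :: nat. lin_form n (a k) x ^ ?e)"
    using Cons unfolding power_sum_def by blast
  have "power_sum n (Suc ?e) (\<Sum>k<fact ?e :: nat. Suc ?e)
      (\<lambda>x. \<Sum>k<fact ?e. lin_form n (a k) x ^ ?e * lin_form n u x ^ 1)"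
    by (intro power_sum_sum power_sum_binary_monomial) auto
  moreover have "prod_list (map (\<lambda>u. lin_form n u x) (u # us)) =
      (\<Sum>k<fact ?e. lin_form n (a k) x ^ ?e * lin_form n u x ^ 1)" for x
    using fun_cong[OF a, of x] by (simp add: sum_distrib_left mult.commute)
  ultimately show ?case by (simp add: mult.commute)
qed

subsection \<open>Forms\<close>

lemma finite_exps: "finite (exps n d)"
proof -
  have "exps n d \<subseteq> {\<alpha>. \<forall>i. (i \<in> {..<n} \<longrightarrow> \<alpha> i \<in> {..d}) \<and> (i \<notin> {..<n} \<longrightarrow> \<alpha> i = 0)}"
    by (auto simp: exps_def intro!: member_le_sum)
  then show ?thesis
    by (rule finite_subset) (intro finite_set_of_finite_funs; simp)
qed

lemma hom_form_monomial:
  assumes "\<alpha> \<in> exps n d"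
  shows "hom_form n d (\<lambda>x. c * (\<Prod>i<n. x i ^ \<alpha> i))"
  unfolding hom_form_def
proof (intro exI[of _ "\<lambda>\<beta>. if \<beta> = \<alpha> then c else 0"] ext)
  fix x :: "nat \<Rightarrow> complex"
  show "c * (\<Prod>i<n. x i ^ \<alpha> i) =
      (\<Sum>\<beta>\<in>exps n d. (if \<beta> = \<alpha> then c else 0) * (\<Prod>i<n. x i ^ \<beta> i))"
    using assms by (subst sum.remove[of _ \<alpha>]) (auto simp: finite_exps intro!: sum.neutral)
qed

lemma hom_form_zero: "hom_form n d (\<lambda>x. 0)"
  unfolding hom_form_def by (intro exI[of _ "\<lambda>_. 0"]) simp

lemma hom_form_add:
  assumes "hom_form n d f" "hom_form n d g"
  shows "hom_form n d (\<lambda>x. f x + g x)"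
proof -
  obtain a b where "f = (\<lambda>x. \<Sum>\<alpha>\<in>exps n d. a \<alpha> * (\<Prod>i<n. x i ^ \<alpha> i))"
    "g = (\<lambda>x. \<Sum>\<alpha>\<in>exps n d. b \<alpha> * (\<Prod>i<n. x i ^ \<alpha> i))"
    using assms unfolding hom_form_def by blast
  then show ?thesis unfolding hom_form_def
    by (intro exI[of _ "\<lambda>\<alpha>. a \<alpha> + b \<alpha>"]) (simp add: sum.distrib distrib_right)
qed

lemma hom_form_sum:
  assumes "\<And>i. i \<in> A \<Longrightarrow> hom_form n d (f i)"
  shows "hom_form n d (\<lambda>x. \<Sum>i\<in>A. f i x)"
  using assms by (induction A rule: infinite_finite_induct) (auto intro: hom_form_zero hom_form_add)

lemma hom_form_mult:
  assumes "hom_form n d f" "hom_form n e g"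
  shows "hom_form n (d + e) (\<lambda>x. f x * g x)"
proof -
  obtain a b where ab: "f = (\<lambda>x. \<Sum>\<alpha>\<in>exps n d. a \<alpha> * (\<Prod>i<n. x i ^ \<alpha> i))"
    "g = (\<lambda>x. \<Sum>\<alpha>\<in>exps n e. b \<alpha> * (\<Prod>i<n. x i ^ \<alpha> i))"
    using assms unfolding hom_form_def by blast
  have "hom_form n (d + e) (\<lambda>x. \<Sum>\<alpha>\<in>exps n d. \<Sum>\<beta>\<in>exps n e.
      (a \<alpha> * b \<beta>) * (\<Prod>i<n. x i ^ (\<alpha> i + \<beta> i)))"
    by (intro hom_form_sum hom_form_monomial) (auto simp: exps_def sum.distrib)
  also have "(\<lambda>x. \<Sum>\<alpha>\<in>exps n d. \<Sum>\<beta>\<in>exps n e.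
      (a \<alpha> * b \<beta>) * (\<Prod>i<n. x i ^ (\<alpha> i + \<beta> i))) = (\<lambda>x. f x * g x)"
    unfolding ab by (simp add: sum_product power_add prod.distrib mult_ac)
  finally show ?thesis .
qed

lemma hom_form_const: "hom_form n 0 (\<lambda>x. c)"
  using hom_form_monomial[of "\<lambda>_. 0" n 0 c] by (simp add: exps_def)

lemma hom_form_coord:
  assumes "i < n" shows "hom_form n 1 (\<lambda>x. x i)"
proof -
  have "(\<lambda>j. if j = i then 1 else 0) \<in> exps n 1"
    using assms by (auto simp: exps_def)
  from hom_form_monomial[OF this, of 1] have
    "hom_form n 1 (\<lambda>x. \<Prod>j<n. x j ^ (if j = i then 1 else 0))" by simp
  moreover have "(\<Prod>j<n. x j ^ (if j = i then 1 else 0)) = x i" for x :: "nat \<Rightarrow> complex"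
    using assms by (subst prod.remove[of _ i]) (auto intro!: prod.neutral)
  ultimately show ?thesis by simp
qed

lemma hom_form_prod:
  assumes "finite A" "\<And>i. i \<in> A \<Longrightarrow> hom_form n (e i) (f i)"
  shows "hom_form n (\<Sum>i\<in>A. e i) (\<lambda>x. \<Prod>i\<in>A. f i x)"
  using assms by (induction A rule: finite_induct) (auto intro: hom_form_const hom_form_mult)

lemma hom_form_power:
  assumes "hom_form n 1 f" shows "hom_form n e (\<lambda>x. f x ^ e)"
  using hom_form_prod[of "{..<e}" n "\<lambda>_. 1" "\<lambda>_. f"] assms by simp

lemma hom_form_substitute:
  assumes "hom_form n e g" "\<And>i. i < n \<Longrightarrow> hom_form s 1 (u i)"
  shows "hom_form s e (\<lambda>z. g (\<lambda>i. u i z))"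
proof -
  obtain a where a: "g = (\<lambda>x. \<Sum>\<alpha>\<in>exps n e. a \<alpha> * (\<Prod>i<n. x i ^ \<alpha> i))"
    using assms unfolding hom_form_def by blast
  have "hom_form s e (\<lambda>z. a \<alpha> * (\<Prod>i<n. u i z ^ \<alpha> i))" if "\<alpha> \<in> exps n e" for \<alpha>
  proof -
    have "hom_form s (0 + (\<Sum>i<n. \<alpha> i)) (\<lambda>z. a \<alpha> * (\<Prod>i<n. u i z ^ \<alpha> i))"
      using assms(2) by (intro hom_form_mult hom_form_const hom_form_prod hom_form_power) auto
    then show ?thesis using that by (simp add: exps_def)
  qed
  then show ?thesis unfolding a by (intro hom_form_sum)
qed

lemma monomial_eq_prod_list:
  fixes \<alpha> :: "nat \<Rightarrow> nat"
  shows "\<exists>is. set is \<subseteq> {..<n} \<and> length is = (\<Sum>i<n. \<alpha> i) \<and>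
    (\<forall>x :: nat \<Rightarrow> complex. (\<Prod>i<n. x i ^ \<alpha> i) = prod_list (map x is))"
proof (induction n)
  case 0
  show ?case by (intro exI[of _ "[]"]) simp
next
  case (Suc n)
  then obtain "is" where IS: "set is \<subseteq> {..<n}" "length is = (\<Sum>i<n. \<alpha> i)"
    "\<And>x :: nat \<Rightarrow> complex. (\<Prod>i<n. x i ^ \<alpha> i) = prod_list (map x is)" by blast
  then show ?case
    by (intro exI[of _ "is @ replicate (\<alpha> n) n"]) auto
qed

text \<open>A crude bound that makes the \<open>LEAST\<close> in \<open>WR\<close> and
  \<open>BWR\<close> attained and the set under the \<open>Max\<close> of \<open>maxR\<close>
  finite.\<close>

lemma power_sum_hom_form:
  assumes "hom_form n e f" "e \<ge> 1"
  shows "power_sum n e (card (exps n e) * fact e) f"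
proof -
  obtain a where a: "f = (\<lambda>x. \<Sum>\<alpha>\<in>exps n e. a \<alpha> * (\<Prod>i<n. x i ^ \<alpha> i))"
    using assms unfolding hom_form_def by blast
  have "power_sum n e (fact e) (\<lambda>x. a \<alpha> * (\<Prod>i<n. x i ^ \<alpha> i))" if \<alpha>: "\<alpha> \<in> exps n e" for \<alpha>
  proof -
    obtain "is" where IS: "set is \<subseteq> {..<n}" "length is = e"
      "\<And>x :: nat \<Rightarrow> complex. (\<Prod>i<n. x i ^ \<alpha> i) = prod_list (map x is)"
      using monomial_eq_prod_list[of n \<alpha>] \<alpha> by (auto simp: exps_def)
    have eq: "prod_list (map (\<lambda>u. lin_form n u x) (map (\<lambda>i j. if j = i then 1 else 0) is)) =
        prod_list (map x is)" for x
      using IS(1) by (auto simp: o_def intro!: arg_cong[of _ _ prod_list] lin_form_unit)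
    show ?thesis
      using power_sum_prod_list[of n "map (\<lambda>i j. if j = i then 1 else 0) is"] IS(2) assms(2)
      unfolding eq IS(3) by (auto intro: power_sum_cmult)
  qed
  then have "power_sum n e (\<Sum>\<alpha>\<in>exps n e. fact e) f"
    unfolding a by (intro power_sum_sum finite_exps) auto
  then show ?thesis by simp
qed

section \<open>Maximal ranks and the partition function\<close>

lemma finite_WR_hom_forms:
  assumes "e \<ge> 1" shows "finite {WR n e h | h. hom_form n e h}"
  by (rule finite_subset[of _ "{..card (exps n e) * fact e}"])
    (auto intro: WR_le power_sum_hom_form assms)

lemma WR_le_maxR:
  assumes "hom_form n e h" "e \<ge> 1" shows "WR n e h \<le> maxR n e"
  unfolding maxR_def using assms finite_WR_hom_forms[of e n] by (auto intro!: Max_ge)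

lemma power_sum_maxR:
  assumes "hom_form n e h" "e \<ge> 1" shows "power_sum n e (maxR n e) h"
  using power_sum_WR[OF power_sum_hom_form[OF assms]] WR_le_maxR[OF assms] assms(2)
  by (rule power_sum_mono)

text \<open>Differentiation in the coordinate 0 is onto: multiply each monomial by x_0 and divide by
  its new exponent. The partial derivative is phrased as an ordinary derivative in a shift
  \<open>t\<close>.\<close>

lemma hom_form_antiderivative:
  assumes "hom_form n d G" "n \<ge> 1"
  shows "\<exists>H. hom_form n (Suc d) H \<and>
    (\<forall>x. ((\<lambda>t. H (\<lambda>i. if i = 0 then x 0 + t else x i)) has_field_derivative G x) (at 0))"
proof -
  obtain a where a: "G = (\<lambda>x. \<Sum>\<alpha>\<in>exps n d. a \<alpha> * (\<Prod>i<n. x i ^ \<alpha> i))"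
    using assms unfolding hom_form_def by blast
  define H where "H x = (\<Sum>\<alpha>\<in>exps n d. x 0 * (a \<alpha> / (of_nat (\<alpha> 0) + 1) * (\<Prod>i<n. x i ^ \<alpha> i)))"
    for x :: "nat \<Rightarrow> complex"
  have "hom_form n (1 + d) H" unfolding H_def
    using assms(2) by (intro hom_form_sum hom_form_mult hom_form_coord hom_form_monomial) auto
  moreover have "((\<lambda>t. H (\<lambda>i. if i = 0 then x 0 + t else x i)) has_field_derivative G x) (at 0)" for x
  proof -
    have split: "(\<Prod>i<n. y i ^ \<alpha> i) = y 0 ^ \<alpha> 0 * (\<Prod>i\<in>{..<n} - {0}. y i ^ \<alpha> i)"
      for y :: "nat \<Rightarrow> complex" and \<alpha>
      using assms(2) by (subst prod.remove[of _ 0]) auto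
    have eq: "H (\<lambda>i. if i = 0 then x 0 + t else x i) = (\<Sum>\<alpha>\<in>exps n d.
        a \<alpha> / (of_nat (\<alpha> 0) + 1) * (\<Prod>i\<in>{..<n} - {0}. x i ^ \<alpha> i) * (x 0 + t) ^ Suc (\<alpha> 0))" for t
      unfolding H_def split by (intro sum.cong) (auto simp: mult_ac)
    have "((\<lambda>t. \<Sum>\<alpha>\<in>exps n d.
        a \<alpha> / (of_nat (\<alpha> 0) + 1) * (\<Prod>i\<in>{..<n} - {0}. x i ^ \<alpha> i) * (x 0 + t) ^ Suc (\<alpha> 0))
        has_field_derivative (\<Sum>\<alpha>\<in>exps n d. a \<alpha> / (of_nat (\<alpha> 0) + 1) *
        (\<Prod>i\<in>{..<n} - {0}. x i ^ \<alpha> i) * (of_nat (Suc (\<alpha> 0)) * (x 0 + 0) ^ \<alpha> 0))) (at 0)"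
      by (rule derivative_eq_intros refl | simp add: mult_ac)+
    moreover have "(\<Sum>\<alpha>\<in>exps n d. a \<alpha> / (of_nat (\<alpha> 0) + 1) *
        (\<Prod>i\<in>{..<n} - {0}. x i ^ \<alpha> i) * (of_nat (Suc (\<alpha> 0)) * (x 0 + 0) ^ \<alpha> 0)) = G x"
      unfolding a split
    proof (intro sum.cong refl)
      fix \<alpha> :: "nat \<Rightarrow> nat"
      have "1 + of_nat (\<alpha> 0) \<noteq> (0::complex)" by (metis of_nat_Suc of_nat_neq_0)
      then show "a \<alpha> / (of_nat (\<alpha> 0) + 1) * (\<Prod>i\<in>{..<n} - {0}. x i ^ \<alpha> i) *
          (of_nat (Suc (\<alpha> 0)) * (x 0 + 0) ^ \<alpha> 0) =
          a \<alpha> * (x 0 ^ \<alpha> 0 * (\<Prod>i\<in>{..<n} - {0}. x i ^ \<alpha> i))"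
        by (simp add: add.commute)
    qed
    ultimately show ?thesis unfolding eq by simp
  qed
  ultimately show ?thesis by auto
qed

lemma power_sum_derivative:
  assumes "power_sum n (Suc d) s H" "n \<ge> 1" "d \<ge> 1"
    and "\<And>x. ((\<lambda>t. H (\<lambda>i. if i = 0 then x 0 + t else x i)) has_field_derivative G x) (at 0)"
  shows "power_sum n d s G"
proof -
  obtain a where a: "H = (\<lambda>x. \<Sum>k<s. lin_form n (a k) x ^ Suc d)"
    using assms(1) unfolding power_sum_def by blast
  have lin: "lin_form n b (\<lambda>i. if i = 0 then x 0 + t else x i) = lin_form n b x + b 0 * t" for b x t
    unfolding lin_form_def using assms(2)
    by (subst (1 2) sum.remove[of _ 0]) (auto simp: algebra_simps)
  have "G x = (\<Sum>k<s. (of_nat (Suc d) * a k 0) * lin_form n (a k) x ^ d)" for x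
  proof (rule DERIV_unique[OF assms(4)])
    show "((\<lambda>t. H (\<lambda>i. if i = 0 then x 0 + t else x i)) has_field_derivative
        (\<Sum>k<s. (of_nat (Suc d) * a k 0) * lin_form n (a k) x ^ d)) (at 0)"
      unfolding a lin
      by (rule derivative_eq_intros refl | simp add: mult_ac)+
  qed
  moreover have "power_sum n d (\<Sum>k<s. 1) (\<lambda>x. \<Sum>k<s. (of_nat (Suc d) * a k 0) * lin_form n (a k) x ^ d)"
    using assms(3) by (intro power_sum_sum power_sum_cmult power_sum_power) auto
  ultimately have "power_sum n d (\<Sum>k<s. 1) G" by presburger
  then show ?thesis by simp
qed

text \<open>A form of degree m is a derivative of one of degree m + 1, and differentiating a
  decomposition of the latter turns each power into a scalar multiple of a power of the same linear
  form.\<close>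

lemma maxR_mono_degree:
  assumes "1 \<le> d" "d \<le> e" "1 \<le> n"
  shows "maxR n d \<le> maxR n e"
  using assms(2)
proof (induction rule: dec_induct)
  case base
  show ?case by simp
next
  case (step m)
  have "WR n m G \<le> maxR n (Suc m)" if G: "hom_form n m G" for G
  proof -
    obtain H where H: "hom_form n (Suc m) H"
      "\<And>x. ((\<lambda>t. H (\<lambda>i. if i = 0 then x 0 + t else x i)) has_field_derivative G x) (at 0)"
      using hom_form_antiderivative[OF G assms(3)] by blast
    have "power_sum n m (maxR n (Suc m)) G"
      using power_sum_derivative[OF power_sum_maxR[OF H(1)] assms(3) _ H(2)] step assms(1) by auto
    then show ?thesis by (rule WR_le)
  qed
  moreover have "{WR n m h | h. hom_form n m h} \<noteq> {}" using hom_form_zero by blast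
  ultimately have "maxR n m \<le> maxR n (Suc m)"
    using finite_WR_hom_forms[of m n] step assms(1) by (subst maxR_def) (auto simp: Max_le_iff)
  with step show ?case by simp
qed

lemma partM_ge:
  fixes m :: nat and p :: "nat \<Rightarrow> nat"
  assumes "\<And>k. k < m \<Longrightarrow> p k \<ge> 1" "(\<Sum>k<m. p k) = r"
  shows "(\<Sum>k<m. maxR (p k) (p k - 1)) \<le> partM r"
proof -
  \<comment> \<open>A partition of \<open>r\<close> has at most \<open>r\<close> parts, and each
    contributes at most \<open>B\<close>. This bound makes the set under the \<open>Max\<close> of
    \<open>partM\<close> finite.\<close>
  define B where "B = (\<Sum>q\<le>r. maxR q (q - 1))"
  have bound: "(\<Sum>k<m. maxR (p k) (p k - 1)) \<le> r * B"
    if p: "\<forall>k<m. p k \<ge> 1" "(\<Sum>k<m. p k) = r" for m and p :: "nat \<Rightarrow> nat"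
  proof -
    have "(\<Sum>k<m. 1) \<le> (\<Sum>k<m. p k)" using p by (intro sum_mono) auto
    then have "m \<le> r" using p by simp
    have "maxR (p k) (p k - 1) \<le> B" if "k < m" for k
    proof -
      have "p k \<le> r" using member_le_sum[of k "{..<m}" p] that p by auto
      then show ?thesis unfolding B_def
        using member_le_sum[of "p k" "{..r}" "\<lambda>q. maxR q (q - 1)"] by simp
    qed
    then have "(\<Sum>k<m. maxR (p k) (p k - 1)) \<le> m * B"
      using sum_bounded_above[of "{..<m}" "\<lambda>k. maxR (p k) (p k - 1)" B] by simp
    also have "\<dots> \<le> r * B" using \<open>m \<le> r\<close> by simp
    finally show ?thesis .
  qed
  have "finite {(\<Sum>k<m. maxR (p k) (p k - 1)) | (m::nat) (p::nat \<Rightarrow> nat).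
      (\<forall>k<m. p k \<ge> 1) \<and> (\<Sum>k<m. p k) = r}"
    by (rule finite_subset[of _ "{..r * B}"]) (use bound in auto)
  then show ?thesis unfolding partM_def using assms by (intro Max_ge CollectI exI[of _ m] exI[of _ p]) auto
qed

lemma partM_ge_partition:
  assumes "finite C" "\<And>c. c \<in> C \<Longrightarrow> p c \<ge> 1" "(\<Sum>c\<in>C. p c) = r"
  shows "(\<Sum>c\<in>C. maxR (p c) (p c - 1)) \<le> partM r"
proof -
  obtain h where h: "bij_betw h {..<card C} C"
    using ex_bij_betw_nat_finite[OF assms(1)] by (auto simp: atLeast0LessThan)
  have "(\<Sum>k<card C. maxR (p (h k)) (p (h k) - 1)) \<le> partM r"
    using h assms(2,3) sum.reindex_bij_betw[OF h, of p]
    by (intro partM_ge) (auto simp: bij_betw_apply)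
  then show ?thesis
    using sum.reindex_bij_betw[OF h, of "\<lambda>c. maxR (p c) (p c - 1)"] by simp
qed

subsection \<open>Essential variables of limits\<close>

lemma homogeneous_system_nontrivial_solution:
  fixes A :: "'a \<Rightarrow> 'b \<Rightarrow> complex"
  assumes "finite I" "finite J" "card I < card J"
  shows "\<exists>c. (\<exists>j\<in>J. c j \<noteq> 0) \<and> (\<forall>k\<in>I. (\<Sum>j\<in>J. c j * A k j) = 0)"
  using assms
proof (induction I arbitrary: J A rule: finite_induct)
  case empty
  then have "J \<noteq> {}" by auto
  then show ?case by (intro exI[of _ "\<lambda>_. 1"]) auto
next
  case (insert k I)
  show ?case
  proof (cases "\<forall>j\<in>J. A k j = 0")
    case True
    obtain c where "\<exists>j\<in>J. c j \<noteq> 0" "\<forall>k\<in>I. (\<Sum>j\<in>J. c j * A k j) = 0"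
      using insert.IH[of J A] insert.prems insert.hyps by (metis Suc_lessD card_insert_disjoint)
    with True show ?thesis by (intro exI[of _ c]) auto
  next
    case False
    then obtain j0 where j0: "j0 \<in> J" "A k j0 \<noteq> 0" by blast
    \<comment> \<open>Gaussian elimination: equation \<open>k\<close> is solved for the unknown
      \<open>j0\<close> and substituted into the others; \<open>c'\<close> below is the back
      substitution.\<close>
    define B where "B k' j = A k' j - A k' j0 * A k j / A k j0" for k' j
    have "card I < card (J - {j0})" using insert j0 by auto
    then obtain c where c: "\<exists>j\<in>J - {j0}. c j \<noteq> 0"
        "\<forall>k'\<in>I. (\<Sum>j\<in>J - {j0}. c j * B k' j) = 0"
      using insert.IH[of "J - {j0}" B] insert.prems by (metis finite_Diff)
    define c' where "c' = c(j0 := - (\<Sum>j\<in>J - {j0}. c j * A k j) / A k j0)"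
    have eq: "(\<Sum>j\<in>J. c' j * A k' j) = (\<Sum>j\<in>J - {j0}. c j * B k' j)" for k'
    proof -
      have "(\<Sum>j\<in>J. c' j * A k' j) = c' j0 * A k' j0 + (\<Sum>j\<in>J - {j0}. c' j * A k' j)"
        using j0 insert by (subst sum.remove[of _ j0]) auto
      also have "(\<Sum>j\<in>J - {j0}. c' j * A k' j) = (\<Sum>j\<in>J - {j0}. c j * A k' j)"
        by (intro sum.cong) (auto simp: c'_def)
      also have "c' j0 * A k' j0 = - (\<Sum>j\<in>J - {j0}. c j * (A k' j0 * A k j / A k j0))"
        by (simp add: c'_def sum_distrib_left sum_distrib_right sum_divide_distrib mult_ac)
      finally show ?thesis by (simp add: B_def sum_subtractf algebra_simps)
    qed
    have "(\<Sum>j\<in>J - {j0}. c j * B k j) = 0"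
      using j0 by (intro sum.neutral) (auto simp: B_def)
    then show ?thesis using c eq
      by (intro exI[of _ c']) (auto simp: c'_def)
  qed
qed

lemma convergent_subseq_finite:
  fixes X :: "'a \<Rightarrow> nat \<Rightarrow> complex"
  assumes "finite A" "\<And>a m. a \<in> A \<Longrightarrow> norm (X a m) \<le> 1"
  shows "\<exists>\<rho>::nat \<Rightarrow> nat. strict_mono \<rho> \<and> (\<forall>a\<in>A. convergent (\<lambda>m. X a (\<rho> m)))"
  using assms
proof (induction A rule: finite_induct)
  case empty
  show ?case by (intro exI[of _ id]) (auto simp: strict_mono_def)
next
  case (insert a A)
  then obtain \<rho> :: "nat \<Rightarrow> nat" where \<rho>: "strict_mono \<rho>" "\<forall>a\<in>A. convergent (\<lambda>m. X a (\<rho> m))"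
    by auto
  have "bounded (range (\<lambda>m. X a (\<rho> m)))"
    using insert.prems by (intro boundedI[of _ 1]) auto
  then obtain l \<sigma> where \<sigma>: "strict_mono \<sigma>" "((\<lambda>m. X a (\<rho> m)) \<circ> \<sigma>) \<longlonglongrightarrow> l"
    using bounded_imp_convergent_subsequence by blast
  have "convergent (\<lambda>m. X b (\<rho> (\<sigma> m)))" if "b \<in> insert a A" for b
  proof (cases "b = a")
    case True
    then show ?thesis using \<sigma>(2) by (auto simp: o_def intro: convergentI)
  next
    case False
    then have "convergent (\<lambda>m. X b (\<rho> m))" using \<rho> that by auto
    from convergent_subseq_convergent[OF this \<sigma>(1)] show ?thesis by (simp add: o_def)
  qed
  then show ?case using \<rho>(1) \<sigma>(1)
    by (intro exI[of _ "\<rho> \<circ> \<sigma>"]) (auto simp: o_def strict_mono_def)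
qed

text \<open>Each \<open>G m\<close> is invariant under the common kernel of \<open>s\<close> linear
  forms, but this kernel moves with \<open>m\<close>. By compactness, any s + 1 vectors have in the
  limit a nontrivial combination along which \<open>g\<close> is invariant, so the invariant
  directions of \<open>g\<close> have codimension at most \<open>s\<close>. As these combinations
  also move and converge only along a subsequence, \<open>lim\<close> asks for convergence with
  moving arguments along subsequences.\<close>

lemma limit_depends_on_few_variables:
  fixes G :: "nat \<Rightarrow> (nat \<Rightarrow> complex) \<Rightarrow> complex" and w :: "'a \<Rightarrow> nat \<Rightarrow> nat \<Rightarrow> complex"
  assumes I: "finite I" "card I = s"
    and g: "hom_form n e g"
    and lim: "\<And>X x \<rho>. strict_mono \<rho> \<Longrightarrow> (\<And>i. i < n \<Longrightarrow> (\<lambda>m. X m i) \<longlonglongrightarrow> x i) \<Longrightarrow>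
        (\<lambda>m. G (\<rho> m) (X m)) \<longlonglongrightarrow> g x"
    and inv: "\<And>m x z. (\<And>k. k \<in> I \<Longrightarrow> lin_form n z (w k m) = 0) \<Longrightarrow>
        G m (\<lambda>i. x i + z i) = G m x"
  shows "\<exists>\<phi> H. hom_form s e H \<and> g = (\<lambda>x. H (\<lambda>l. lin_form n (\<phi> l) x))"
proof -
  define Z where "Z = {z. \<forall>x (t::complex). g (\<lambda>i. x i + t * z i) = g x}"
  have Zinv: "g (\<lambda>i. x i + t * z i) = g x" if "z \<in> Z" for x t z
    using that by (simp add: Z_def)
  have Z0: "(\<lambda>i. 0) \<in> Z" by (simp add: Z_def)
  have Zadd: "(\<lambda>i. z i + z' i) \<in> Z" if "z \<in> Z" "z' \<in> Z" for z z'
  proof -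
    have "g (\<lambda>i. x i + t * (z i + z' i)) = g x" for x t
    proof -
      have "g (\<lambda>i. (x i + t * z i) + t * z' i) = g (\<lambda>i. x i + t * z i)"
        by (rule Zinv[OF that(2)])
      also have "\<dots> = g x" by (rule Zinv[OF that(1)])
      finally show ?thesis by (simp add: algebra_simps)
    qed
    then show ?thesis by (simp add: Z_def)
  qed
  have Zscale: "(\<lambda>i. c * z i) \<in> Z" if "z \<in> Z" for z c
  proof -
    have "g (\<lambda>i. x i + (t * c) * z i) = g x" for x t by (rule Zinv[OF that])
    then show ?thesis by (simp add: Z_def mult.assoc)
  qed
  have Zsum: "(\<lambda>i. \<Sum>a\<in>A. c a * z a i) \<in> Z" if "\<And>a. a \<in> A \<Longrightarrow> z a \<in> Z"
    for A :: "nat set" and c z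
    using that by (induction A rule: infinite_finite_induct) (auto simp: Z0 intro!: Zadd Zscale)

  have dep: "\<exists>c. (\<exists>j\<le>s. c j \<noteq> 0) \<and> (\<lambda>i. \<Sum>j\<le>s. c j * E j i) \<in> Z"
    for E :: "nat \<Rightarrow> nat \<Rightarrow> complex"
  proof -
    have "\<exists>c. (\<Sum>j\<le>s. norm (c j)) = 1 \<and> (\<forall>k\<in>I. (\<Sum>j\<le>s. c j * lin_form n (E j) (w k m)) = 0)" for m
    proof -
      obtain c where c: "\<exists>j\<in>{..s}. c j \<noteq> 0" "\<forall>k\<in>I. (\<Sum>j\<le>s. c j * lin_form n (E j) (w k m)) = 0"
        using homogeneous_system_nontrivial_solution[of I "{..s}" "\<lambda>k j. lin_form n (E j) (w k m)"] I
        by auto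
      \<comment> \<open>Normalizing the coefficients to total norm 1 bounds them and keeps their
        limit nonzero.\<close>
      define N where "N = (\<Sum>j\<le>s. norm (c j))"
      have "N > 0" unfolding N_def using c(1) by (auto intro!: sum_pos2)
      then show ?thesis using c(2)
        by (intro exI[of _ "\<lambda>j. c j / of_real N"])
          (auto simp: norm_divide sum_divide_distrib[symmetric] N_def[symmetric])
    qed
    then obtain c where c: "\<And>m. (\<Sum>j\<le>s. norm (c m j)) = 1"
        "\<And>m k. k \<in> I \<Longrightarrow> (\<Sum>j\<le>s. c m j * lin_form n (E j) (w k m)) = 0"
      by metis
    have "norm (c m j) \<le> 1" if "j \<in> {..s}" for m j
      using member_le_sum[of j "{..s}" "\<lambda>j. norm (c m j)"] c(1)[of m] that by auto
    then obtain \<rho> :: "nat \<Rightarrow> nat" where \<rho>: "strict_mono \<rho>" "\<forall>j\<in>{..s}. convergent (\<lambda>m. c (\<rho> m) j)"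
      using convergent_subseq_finite[of "{..s}" "\<lambda>j m. c m j"] by auto
    then have "\<forall>j. \<exists>l. j \<le> s \<longrightarrow> (\<lambda>m. c (\<rho> m) j) \<longlonglongrightarrow> l" by (auto simp: convergent_def)
    then obtain c' where c': "\<And>j. j \<le> s \<Longrightarrow> (\<lambda>m. c (\<rho> m) j) \<longlonglongrightarrow> c' j" by metis
    have "(\<lambda>m. \<Sum>j\<le>s. norm (c (\<rho> m) j)) \<longlonglongrightarrow> (\<Sum>j\<le>s. norm (c' j))"
      by (intro tendsto_intros c') auto
    then have "(\<Sum>j\<le>s. norm (c' j)) = 1"
      by (simp add: c(1) LIMSEQ_const_iff)
    then have "\<exists>j\<le>s. c' j \<noteq> 0"
      by (metis (no_types, lifting) atMost_iff norm_zero sum.neutral zero_neq_one)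
    moreover have "g (\<lambda>i. x i + t * (\<Sum>j\<le>s. c' j * E j i)) = g x" for x t
    proof -
      have "(\<lambda>m. G (\<rho> m) (\<lambda>i. x i + t * (\<Sum>j\<le>s. c (\<rho> m) j * E j i)))
          \<longlonglongrightarrow> g (\<lambda>i. x i + t * (\<Sum>j\<le>s. c' j * E j i))"
        by (intro lim \<rho>(1) tendsto_intros c') auto
      moreover have "(\<lambda>m. G (\<rho> m) x) \<longlonglongrightarrow> g x" by (intro lim \<rho>(1) tendsto_const)
      moreover have "G (\<rho> m) (\<lambda>i. x i + t * (\<Sum>j\<le>s. c (\<rho> m) j * E j i)) = G (\<rho> m) x" for m
        by (rule inv) (simp add: lin_form_cmult lin_form_sum c(2))
      ultimately show ?thesis using LIMSEQ_unique by simp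
    qed
    then have "(\<lambda>i. \<Sum>j\<le>s. c' j * E j i) \<in> Z" by (simp add: Z_def)
    ultimately show ?thesis by blast
  qed

  \<comment> \<open>Linear independence modulo the subspace \<open>Z\<close>. At most
    \<open>s\<close> vectors can be independent, so a family \<open>E\<close> of maximal length
    \<open>q\<close> exists and spans everything modulo \<open>Z\<close>.\<close>
  define indep where "indep q E \<longleftrightarrow> (\<forall>c. (\<lambda>i. \<Sum>j<q. c j * E j i) \<in> Z \<longrightarrow> (\<forall>j<q. c j = 0))"
    for q :: nat and E :: "nat \<Rightarrow> nat \<Rightarrow> complex"
  have notindep: "\<not> indep (Suc s) E" for E
    using dep[of E] unfolding indep_def lessThan_Suc_atMost by (auto simp: less_Suc_eq_le)
  define P where "P q \<longleftrightarrow> q \<le> s \<and> (\<exists>E. indep q E)" for q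
  define q where "q = (GREATEST q. P q)"
  have "P 0" by (auto simp: P_def indep_def)
  then have "P q" unfolding q_def by (rule GreatestI_nat[of _ _ s]) (auto simp: P_def)
  then obtain E where E: "q \<le> s" "indep q E" by (auto simp: P_def)
  have max: "\<not> indep (Suc q) E'" for E'
  proof
    assume "indep (Suc q) E'"
    moreover from this have "Suc q \<noteq> Suc s" using notindep by blast
    ultimately have "P (Suc q)" using E by (auto simp: P_def)
    then have "Suc q \<le> q" unfolding q_def by (rule Greatest_le_nat[of _ _ s]) (auto simp: P_def)
    then show False by simp
  qed
  have span: "\<exists>c. (\<lambda>i. x i - (\<Sum>j<q. c j * E j i)) \<in> Z" for x
  proof -
    obtain c where c: "(\<lambda>i. \<Sum>j<Suc q. c j * (E(q := x)) j i) \<in> Z" "\<exists>j<Suc q. c j \<noteq> 0"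
      using max[of "E(q := x)"] unfolding indep_def by blast
    have c1: "(\<lambda>i. (\<Sum>j<q. c j * E j i) + c q * x i) \<in> Z" using c(1) by simp
    have "c q \<noteq> 0"
    proof
      assume "c q = 0"
      then have "\<forall>j<q. c j = 0" using c1 E(2) by (auto simp: indep_def)
      then show False using \<open>c q = 0\<close> c(2) less_Suc_eq by auto
    qed
    have "(\<lambda>i. 1 / c q * ((\<Sum>j<q. c j * E j i) + c q * x i)) \<in> Z" by (rule Zscale[OF c1])
    moreover have "1 / c q * ((\<Sum>j<q. c j * E j i) + c q * x i) =
        x i - (\<Sum>j<q. - (c j / c q) * E j i)" for i
      using \<open>c q \<noteq> 0\<close> by (simp add: distrib_left sum_distrib_left sum_negf)
    ultimately have "(\<lambda>i. x i - (\<Sum>j<q. - (c j / c q) * E j i)) \<in> Z" by simp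
    then show ?thesis by (rule exI[of _ "\<lambda>j. - (c j / c q)"])
  qed
  have "\<forall>b. \<exists>c. (\<lambda>i. (if i = b then 1 else 0) - (\<Sum>j<q. c j * E j i)) \<in> Z"
    by (intro allI span)
  then obtain C where C: "\<And>b. (\<lambda>i. (if i = b then 1 else 0) - (\<Sum>j<q. C b j * E j i)) \<in> Z" by metis

  \<comment> \<open>\<open>H\<close> is \<open>g\<close> on the span of \<open>E\<close>, as a form
    in the coordinates with respect to \<open>E\<close>; only \<open>q\<close> of the
    \<open>s\<close> variables occur. \<open>C b\<close> holds the coordinates of the b-th unit
    vector modulo \<open>Z\<close>.\<close>
  define H where "H z = g (\<lambda>i. \<Sum>j<q. E j i * z j)" for z
  have "hom_form s e H" unfolding H_def
  proof (rule hom_form_substitute[OF g])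
    fix i
    have "hom_form s (0 + 1) (\<lambda>z. E j i * z j)" if "j < q" for j
      using that E(1) by (intro hom_form_mult hom_form_const hom_form_coord) auto
    then show "hom_form s 1 (\<lambda>z. \<Sum>j<q. E j i * z j)" by (intro hom_form_sum) auto
  qed
  moreover have "g x = H (\<lambda>l. lin_form n (\<lambda>b. C b l) x)" for x
  proof -
    obtain a where a: "g = (\<lambda>x. \<Sum>\<alpha>\<in>exps n e. a \<alpha> * (\<Prod>i<n. x i ^ \<alpha> i))"
      using g unfolding hom_form_def by blast
    \<comment> \<open>The difference between \<open>x\<close> and its representative in the span of
      \<open>E\<close>, correct on the coordinates below \<open>n\<close>, which are all that
      \<open>g\<close> reads.\<close>
    define z where "z = (\<lambda>i. \<Sum>b<n. x b * ((if i = b then 1 else 0) - (\<Sum>j<q. C b j * E j i)))"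
    have "z \<in> Z" unfolding z_def by (intro Zsum C)
    then have "g (\<lambda>i. (\<Sum>j<q. E j i * lin_form n (\<lambda>b. C b j) x) + 1 * z i) =
        g (\<lambda>i. \<Sum>j<q. E j i * lin_form n (\<lambda>b. C b j) x)"
      by (rule Zinv)
    moreover have "(\<Sum>j<q. E j i * lin_form n (\<lambda>b. C b j) x) + 1 * z i = x i" if "i < n" for i
    proof -
      have "(\<Sum>b<n. x b * (if i = b then 1 else 0)) = x i"
        using that by (subst sum.remove[of _ i]) (auto intro!: sum.neutral)
      moreover have "(\<Sum>b<n. x b * (\<Sum>j<q. C b j * E j i)) =
          (\<Sum>j<q. E j i * lin_form n (\<lambda>b. C b j) x)"
        unfolding lin_form_def sum_distrib_left by (subst sum.swap) (simp add: mult_ac)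
      ultimately show ?thesis
        by (simp add: z_def right_diff_distrib sum_subtractf)
    qed
    then have "g (\<lambda>i. (\<Sum>j<q. E j i * lin_form n (\<lambda>b. C b j) x) + 1 * z i) = g x"
      unfolding a by (intro sum.cong prod.cong arg_cong2[of _ _ _ _ "(*)"]) auto
    ultimately show ?thesis by (simp add: H_def)
  qed
  ultimately show ?thesis by (intro exI[of _ "\<lambda>l b. C b l"] exI[of _ H]) auto
qed

section \<open>Limits of sums of products of linear forms\<close>

text \<open>Coefficients are indexed by tuples of variables, without symmetrizing, so that a product
  of linear forms expands directly and convergence of coefficients gives convergence at moving
  arguments.\<close>

definition tensor_form ::
    "nat \<Rightarrow> nat \<Rightarrow> ((nat \<Rightarrow> nat) \<Rightarrow> complex) \<Rightarrow> (nat \<Rightarrow> complex) \<Rightarrow> complex" where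
  "tensor_form n e c x = (\<Sum>i\<in>PiE {..<e} (\<lambda>_. {..<n}). c i * (\<Prod>j<e. x (i j)))"

lemma hom_form_tensor_form: "hom_form n e (tensor_form n e c)"
proof -
  have "hom_form n (0 + (\<Sum>j<e. 1)) (\<lambda>x. c i * (\<Prod>j<e. x (i j)))"
    if "i \<in> PiE {..<e} (\<lambda>_. {..<n})" for i
    using that by (intro hom_form_mult hom_form_const hom_form_prod hom_form_coord) auto
  then show ?thesis unfolding tensor_form_def by (intro hom_form_sum) simp
qed

lemma tensor_form_tendsto:
  assumes "\<And>i. i \<in> PiE {..<e} (\<lambda>_. {..<n}) \<Longrightarrow> (\<lambda>m. c m i) \<longlonglongrightarrow> c' i"
    and "\<And>i. i < n \<Longrightarrow> (\<lambda>m. X m i) \<longlonglongrightarrow> x i"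
  shows "(\<lambda>m. tensor_form n e (c m) (X m)) \<longlonglongrightarrow> tensor_form n e c' x"
  unfolding tensor_form_def using assms by (intro tendsto_intros) (auto simp: PiE_def Pi_def)

lemma sum_prod_lin_form_eq_tensor_form:
  assumes "finite A"
  shows "(\<Sum>k\<in>A. lam k * (\<Prod>j<e. lin_form n (u k j) x)) =
    tensor_form n e (\<lambda>i. \<Sum>k\<in>A. lam k * (\<Prod>j<e. u k j (i j))) x"
proof -
  have "(\<Prod>j<e. lin_form n (u k j) x) =
      (\<Sum>i\<in>PiE {..<e} (\<lambda>_. {..<n}). (\<Prod>j<e. u k j (i j)) * (\<Prod>j<e. x (i j)))" for k
    unfolding lin_form_def by (subst prod_sum_PiE) (auto simp: prod.distrib)
  then show ?thesis
    unfolding tensor_form_def sum_distrib_left sum_distrib_right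
    by (simp add: mult.assoc sum_distrib_left) (subst sum.swap, simp)
qed

text \<open>Hypothesis \<open>conv\<close> says that the tensor coefficients converge; this upgrades
  the pointwise limit \<open>g\<close> to the convergence at moving arguments demanded above. By
  \<open>ann\<close> every factor vanishes on the common kernel of the forms \<open>w k m\<close>,
  which gives the invariance.\<close>

lemma limit_power_sums_essential_variables:
  fixes w :: "'a \<Rightarrow> nat \<Rightarrow> nat \<Rightarrow> complex" and u :: "nat \<Rightarrow> 'b \<Rightarrow> nat \<Rightarrow> nat \<Rightarrow> complex"
  assumes I: "finite I" "card I = s" and A: "finite A"
    and conv: "\<And>i. (\<And>j. j < e \<Longrightarrow> i j < n) \<Longrightarrow>
        convergent (\<lambda>m. \<Sum>k\<in>A. lam m k * (\<Prod>j<e. u m k j (i j)))"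
    and g: "\<And>x. (\<lambda>m. \<Sum>k\<in>A. lam m k * (\<Prod>j<e. lin_form n (u m k j) x)) \<longlonglongrightarrow> g x"
    and ann: "\<And>m z k j. (\<And>k. k \<in> I \<Longrightarrow> lin_form n z (w k m) = 0) \<Longrightarrow> k \<in> A \<Longrightarrow> j < e \<Longrightarrow>
        lin_form n (u m k j) z = 0"
  shows "\<exists>\<phi> H. hom_form s e H \<and> g = (\<lambda>x. H (\<lambda>l. lin_form n (\<phi> l) x))"
proof -
  define T where "T = PiE {..<e} (\<lambda>_. {..<n})"
  define c where "c m i = (\<Sum>k\<in>A. lam m k * (\<Prod>j<e. u m k j (i j)))" for m i
  define G where "G m x = tensor_form n e (c m) x" for m x
  have G: "G m x = (\<Sum>k\<in>A. lam m k * (\<Prod>j<e. lin_form n (u m k j) x))" for m x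
    unfolding G_def c_def using A by (simp add: sum_prod_lin_form_eq_tensor_form)
  have c: "(\<lambda>m. c m i) \<longlonglongrightarrow> lim (\<lambda>m. c m i)" if "i \<in> T" for i
    unfolding convergent_LIMSEQ_iff[symmetric] c_def
    using that by (intro conv) (auto simp: T_def PiE_def Pi_def)
  define g' where "g' = tensor_form n e (\<lambda>i. lim (\<lambda>m. c m i))"
  have lim: "(\<lambda>m. G (\<rho> m) (X m)) \<longlonglongrightarrow> g' x"
    if "strict_mono \<rho>" "\<And>i. i < n \<Longrightarrow> (\<lambda>m. X m i) \<longlonglongrightarrow> x i" for X x \<rho>
    unfolding G_def g'_def
    using LIMSEQ_subseq_LIMSEQ[OF c that(1)] that(2)
    by (intro tensor_form_tendsto) (auto simp: T_def o_def)
  have "g = g'"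
  proof
    fix x
    have "(\<lambda>m. G m x) \<longlonglongrightarrow> g' x" using lim[of id "\<lambda>_. x" x] by (simp add: strict_mono_def)
    moreover have "(\<lambda>m. G m x) \<longlonglongrightarrow> g x" unfolding G by (rule g)
    ultimately show "g x = g' x" by (rule LIMSEQ_unique[symmetric])
  qed
  moreover have "\<exists>\<phi> H. hom_form s e H \<and> g' = (\<lambda>x. H (\<lambda>l. lin_form n (\<phi> l) x))"
  proof (rule limit_depends_on_few_variables[OF I, where G = G and w = w])
    show "hom_form n e g'" unfolding g'_def by (rule hom_form_tensor_form)
    show "(\<lambda>m. G (\<rho> m) (X m)) \<longlonglongrightarrow> g' x"
      if "strict_mono \<rho>" "\<And>i. i < n \<Longrightarrow> (\<lambda>m. X m i) \<longlonglongrightarrow> x i" for X x \<rho>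
      by (rule lim[OF that])
    show "G m (\<lambda>i. x i + z i) = G m x" if "\<And>k. k \<in> I \<Longrightarrow> lin_form n z (w k m) = 0" for m x z
    proof -
      have "lin_form n (u m k j) (\<lambda>i. x i + z i) = lin_form n (u m k j) x"
        if "k \<in> A" "j < e" for k j
        using ann[OF \<open>\<And>k. k \<in> I \<Longrightarrow> lin_form n z (w k m) = 0\<close> that]
        by (simp add: lin_form_commute[of n "u m k j"] lin_form_add)
      then show ?thesis unfolding G by (intro sum.cong prod.cong arg_cong2[of _ _ _ _ "(*)"]) auto
    qed
  qed
  ultimately show ?thesis by simp
qed

subsection \<open>Polynomial functions on moving points\<close>

text \<open>\<open>moving_poly n w e h\<close>: the values \<open>h m k\<close> at the points \<open>w k m\<close> of a polynomial of degree
  less than \<open>e\<close> in \<open>n\<close> variables whose coefficients depend convergently on \<open>m\<close>.\<close>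

inductive moving_poly ::
    "nat \<Rightarrow> ('k \<Rightarrow> nat \<Rightarrow> nat \<Rightarrow> complex) \<Rightarrow> nat \<Rightarrow> (nat \<Rightarrow> 'k \<Rightarrow> complex) \<Rightarrow> bool"
  for n w where
  zero: "moving_poly n w e (\<lambda>m k. 0)"
| const: "convergent c \<Longrightarrow> moving_poly n w (Suc e) (\<lambda>m k. c m)"
| var: "i < n \<Longrightarrow> moving_poly n w e h \<Longrightarrow> moving_poly n w (Suc e) (\<lambda>m k. w k m i * h m k)"
| add: "moving_poly n w e h \<Longrightarrow> moving_poly n w e h' \<Longrightarrow> moving_poly n w e (\<lambda>m k. h m k + h' m k)"

lemma moving_poly_mono:
  assumes "moving_poly n w e h" "e \<le> e'"
  shows "moving_poly n w e' h"
  using assms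
proof (induction arbitrary: e' rule: moving_poly.induct)
  case (const c e)
  then obtain e'' where "e' = Suc e''" by (cases e') auto
  then show ?case using const by (auto intro: moving_poly.const)
next
  case (var i e h)
  then obtain e'' where "e' = Suc e''" "e \<le> e''" by (cases e') auto
  then show ?case using var by (auto intro: moving_poly.var)
qed (auto intro: moving_poly.zero moving_poly.add)

lemma moving_poly_scale:
  assumes "moving_poly n w e h" "convergent c"
  shows "moving_poly n w e (\<lambda>m k. c m * h m k)"
  using assms
proof (induction rule: moving_poly.induct)
  case (var i e h)
  then show ?case using moving_poly.var[of i n w e "\<lambda>m k. c m * h m k"]
    by (simp add: mult.left_commute)
qed (auto simp: distrib_left intro: moving_poly.zero moving_poly.add moving_poly.const convergent_mult)

lemma moving_poly_diff:
  assumes "moving_poly n w e h" "moving_poly n w e h'"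
  shows "moving_poly n w e (\<lambda>m k. h m k - h' m k)"
  using moving_poly.add[OF assms(1) moving_poly_scale[OF assms(2), of "\<lambda>_. -1"]]
  by (simp add: convergent_const)

lemma moving_poly_mult:
  assumes "moving_poly n w e h" "moving_poly n w e' h'"
  shows "\<exists>E. moving_poly n w E (\<lambda>m k. h m k * h' m k)"
  using assms
proof (induction rule: moving_poly.induct)
  case (zero e)
  show ?case using moving_poly.zero by auto
next
  case (const c e)
  then show ?case using moving_poly_scale by blast
next
  case (var i e h)
  then obtain E where "moving_poly n w E (\<lambda>m k. h m k * h' m k)" by blast
  from moving_poly.var[OF var(1) this] show ?case by (auto simp: mult.assoc)
next
  case (add e h g)
  then obtain E1 E2 where E: "moving_poly n w E1 (\<lambda>m k. h m k * h' m k)"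
    "moving_poly n w E2 (\<lambda>m k. g m k * h' m k)" by blast
  have "moving_poly n w (max E1 E2) (\<lambda>m k. h m k * h' m k + g m k * h' m k)"
    by (intro moving_poly.add moving_poly_mono[OF E(1)] moving_poly_mono[OF E(2)]) auto
  then show ?case by (auto simp: distrib_right)
qed

text \<open>The product of the two factors \<open>x - x(w\<^sub>j)\<close> and \<open>h - h'\<close>, where \<open>h'\<close> agrees with \<open>h\<close> on
  \<open>J - {j}\<close>, vanishes on \<open>J\<close>; this expresses the leading term \<open>x * h\<close> by terms of lower degree.\<close>

lemma moving_poly_reduce_step:
  assumes "moving_poly n w e h"
    and "finite J" "e = Suc (card J)"
    and "\<And>j i. j \<in> J \<Longrightarrow> i < n \<Longrightarrow> convergent (\<lambda>m. w j m i)"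
  shows "\<exists>h'. moving_poly n w (card J) h' \<and> (\<forall>m. \<forall>k\<in>J. h m k = h' m k)"
  using assms
proof (induction arbitrary: J rule: moving_poly.induct)
  case (zero e)
  show ?case using moving_poly.zero by auto
next
  case (const c e)
  show ?case
  proof (cases "J = {}")
    case True
    then show ?thesis using moving_poly.zero by auto
  next
    case False
    then have "card J = Suc (card J - 1)" using const.prems(1) by (simp add: card_gt_0_iff)
    then have "moving_poly n w (card J) (\<lambda>m k. c m)"
      using moving_poly.const[OF const(1)] by metis
    then show ?thesis by auto
  qed
next
  case (var i e h)
  show ?case
  proof (cases "J = {}")
    case True
    then show ?thesis using moving_poly.zero by auto
  next
    case False
    then obtain j where j: "j \<in> J" by blast
    have e: "e = Suc (card (J - {j}))"
      using j var.prems(1,2) by (metis card.remove nat.inject)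
    obtain h' where h': "moving_poly n w (card (J - {j})) h'"
        "\<And>m k. k \<in> J - {j} \<Longrightarrow> h m k = h' m k"
      using var.IH[of "J - {j}"] e var.prems by auto
    define g where "g m k = w k m i * h' m k + w j m i * (h m k - h' m k)" for m k
    have "moving_poly n w (Suc (card (J - {j}))) g"
      unfolding g_def using h'(1) var(1,2) e var.prems(3)[OF j]
      by (auto intro!: moving_poly.add moving_poly.var moving_poly_scale moving_poly_diff
          intro: moving_poly_mono)
    moreover have "w k m i * h m k = g m k" if "k \<in> J" for m k
      using h'(2)[of k m] that by (cases "k = j") (auto simp: g_def algebra_simps)
    ultimately show ?thesis using e var.prems(2) by auto
  qed
next
  case (add e h g)
  obtain h' g' where "moving_poly n w (card J) h'" "\<forall>m. \<forall>k\<in>J. h m k = h' m k"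
    "moving_poly n w (card J) g'" "\<forall>m. \<forall>k\<in>J. g m k = g' m k"
    using add.IH(1)[OF add.prems] add.IH(2)[OF add.prems] by blast
  then show ?case by (intro exI[of _ "\<lambda>m k. h' m k + g' m k"]) (auto intro: moving_poly.add)
qed

text \<open>After the inner polynomial has been reduced, one multiplication by a variable raises the
  degree by one only, which a single reduction step repairs. No difference of points is ever divided
  by, so the coefficients stay convergent even where points collide in the limit.\<close>

lemma moving_poly_reduce:
  assumes "moving_poly n w e h"
    and "finite J" and "\<And>j i. j \<in> J \<Longrightarrow> i < n \<Longrightarrow> convergent (\<lambda>m. w j m i)"
  shows "\<exists>h'. moving_poly n w (card J) h' \<and> (\<forall>m. \<forall>k\<in>J. h m k = h' m k)"
  using assms(1)
proof (induction rule: moving_poly.induct)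
  case (zero e)
  show ?case using moving_poly.zero by auto
next
  case (const c e)
  then show ?case
    using moving_poly_reduce_step[OF moving_poly.const assms(2) refl assms(3)] by auto
next
  case (var i e h)
  then obtain h' where h': "moving_poly n w (card J) h'" "\<forall>m. \<forall>k\<in>J. h m k = h' m k" by blast
  obtain g where "moving_poly n w (card J) g" "\<forall>m. \<forall>k\<in>J. w k m i * h' m k = g m k"
    using moving_poly_reduce_step[OF moving_poly.var[OF var(1) h'(1)] assms(2) refl assms(3)] by blast
  then show ?case using h'(2) by auto
next
  case (add e h g)
  then obtain h' g' where "moving_poly n w (card J) h'" "\<forall>m. \<forall>k\<in>J. h m k = h' m k"
    "moving_poly n w (card J) g'" "\<forall>m. \<forall>k\<in>J. g m k = g' m k"
    by blast
  then show ?case by (intro exI[of _ "\<lambda>m k. h' m k + g' m k"]) (auto intro: moving_poly.add)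
qed

section \<open>Weighted points whose functional converges in degree \<open>d\<close>\<close>

text \<open>The points lie in the affine chart t = 1 and converge, while nothing bounds the weights
  \<open>lam\<close>: they may diverge and cancel. \<open>conv\<close> tests the functional on all
  products of \<open>d\<close> linear forms, and \<open>r_le\<close> makes \<open>d\<close> at least
  the degree r - 1 to which polynomials on \<open>r\<close> points reduce.\<close>

locale convergent_weighted_points =
  fixes n d r :: nat
    and w :: "nat \<Rightarrow> nat \<Rightarrow> nat \<Rightarrow> complex" and w0 :: "nat \<Rightarrow> nat \<Rightarrow> complex"
    and lam :: "nat \<Rightarrow> nat \<Rightarrow> complex" and t :: "nat \<Rightarrow> complex"
  assumes w_lim: "\<And>k i. k < r \<Longrightarrow> i < n \<Longrightarrow> (\<lambda>m. w k m i) \<longlonglongrightarrow> w0 k i"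
    and t_one: "\<And>k m. k < r \<Longrightarrow> lin_form n t (w k m) = 1"
    and conv: "\<And>bs. length bs = d \<Longrightarrow>
      convergent (\<lambda>m. \<Sum>k<r. lam m k * prod_list (map (\<lambda>b. lin_form n b (w k m)) bs))"
    and r_le: "r \<le> Suc d"
begin

definition mp :: "(nat \<Rightarrow> nat \<Rightarrow> complex) \<Rightarrow> bool" where
  "mp h \<longleftrightarrow> (\<exists>e. moving_poly n w e h)"

lemma mp_const: "convergent c \<Longrightarrow> mp (\<lambda>m k. c m)"
  unfolding mp_def using moving_poly.const by blast

lemma mp_add: assumes "mp h" "mp h'" shows "mp (\<lambda>m k. h m k + h' m k)"
proof -
  obtain E1 E2 where "moving_poly n w E1 h" "moving_poly n w E2 h'"
    using assms unfolding mp_def by blast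
  then have "moving_poly n w (max E1 E2) (\<lambda>m k. h m k + h' m k)"
    by (intro moving_poly.add) (auto elim: moving_poly_mono)
  then show ?thesis unfolding mp_def by blast
qed

lemma mp_mult: "mp h \<Longrightarrow> mp h' \<Longrightarrow> mp (\<lambda>m k. h m k * h' m k)"
  unfolding mp_def using moving_poly_mult by blast

lemma mp_diff: assumes "mp h" "mp h'" shows "mp (\<lambda>m k. h m k - h' m k)"
  using mp_add[OF assms(1) mp_mult[OF mp_const[of "\<lambda>_. -1"] assms(2)]]
  by (simp add: convergent_const)

lemma mp_var: assumes "i < n" shows "mp (\<lambda>m k. w k m i)"
proof -
  have "moving_poly n w 2 (\<lambda>m k. w k m i * 1)"
    unfolding numeral_2_eq_2
    by (intro moving_poly.var[OF assms] moving_poly.const convergent_const)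
  then show ?thesis by (auto simp: mp_def)
qed

lemma mp_sum: "(\<And>a. a \<in> A \<Longrightarrow> mp (h a)) \<Longrightarrow> mp (\<lambda>m k. \<Sum>a\<in>A. h a m k)"
  by (induction A rule: infinite_finite_induct) (auto intro: mp_add mp_const convergent_const)

lemma mp_prod: "(\<And>a. a \<in> A \<Longrightarrow> mp (h a)) \<Longrightarrow> mp (\<lambda>m k. \<Prod>a\<in>A. h a m k)"
  by (induction A rule: infinite_finite_induct) (auto intro: mp_mult mp_const convergent_const)

lemma mp_power: "mp h \<Longrightarrow> mp (\<lambda>m k. h m k ^ a)"
  by (induction a) (auto intro: mp_mult mp_const convergent_const)

lemma mp_lin_form: "mp (\<lambda>m k. lin_form n x (w k m))"
  unfolding lin_form_def by (intro mp_sum mp_mult mp_const mp_var convergent_const) auto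

lemma convergent_w: "k < r \<Longrightarrow> i < n \<Longrightarrow> convergent (\<lambda>m. w k m i)"
  using w_lim convergentI by blast

lemma lin_form_w_tendsto: "k < r \<Longrightarrow> (\<lambda>m. lin_form n x (w k m)) \<longlonglongrightarrow> lin_form n x (w0 k)"
  unfolding lin_form_def by (intro tendsto_intros w_lim) auto

text \<open>The list \<open>is\<close> accumulates the variables already split off from the
  polynomial. Since \<open>e\<close> bounds the degree strictly, \<open>Suc d\<close> is the right
  bound.\<close>

lemma convergent_low_degree:
  assumes "moving_poly n w e h" "e + length is \<le> Suc d" "set is \<subseteq> {..<n}"
  shows "convergent (\<lambda>m. \<Sum>k<r. lam m k * (h m k * prod_list (map (w k m) is)))"
  using assms
proof (induction arbitrary: "is" rule: moving_poly.induct)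
  case (zero e)
  show ?case by (simp add: convergent_const)
next
  case (const c e)
  \<comment> \<open>Homogenization: copies of \<open>t\<close>, which is 1 on the points, fill the
    monomial up to degree exactly \<open>d\<close>.\<close>
  define bs where "bs = map (\<lambda>i j. if j = i then 1 else (0::complex)) is @ replicate (d - length is) t"
  have "prod_list (map (\<lambda>b. lin_form n b (w k m)) bs) = prod_list (map (w k m) is)"
    if "k < r" for k m
  proof -
    have "map (\<lambda>b. lin_form n b (w k m)) (map (\<lambda>i j. if j = i then 1 else (0::complex)) is) = map (w k m) is"
      using const.prems(2) by (auto intro!: lin_form_unit)
    then show ?thesis by (simp add: bs_def t_one[OF that] del: map_map)
  qed
  then have "convergent (\<lambda>m. \<Sum>k<r. lam m k * prod_list (map (w k m) is))"
    using conv[of bs] const.prems(1) by (simp add: bs_def)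
  from convergent_mult[OF const(1) this] show ?case by (simp add: sum_distrib_left mult_ac)
next
  case (var i e h)
  then show ?case using var.IH[of "i # is"] by (simp add: mult_ac)
next
  case (add e h g)
  from convergent_add[OF add.IH(1)[OF add.prems] add.IH(2)[OF add.prems]] show ?case
    by (simp add: sum.distrib[symmetric] algebra_simps)
qed

lemma convergent_mp:
  assumes "mp h" shows "convergent (\<lambda>m. \<Sum>k<r. lam m k * h m k)"
proof -
  obtain e where e: "moving_poly n w e h" using assms unfolding mp_def by blast
  obtain h' where h': "moving_poly n w (card {..<r}) h'" "\<forall>m. \<forall>k\<in>{..<r}. h m k = h' m k"
    using moving_poly_reduce[OF e, of "{..<r}"] convergent_w by auto
  from convergent_low_degree[OF h'(1), of "[]"] h'(2) r_le show ?thesis by simp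
qed

text \<open>Each \<open>p i\<close> is a Lagrange product, 1 at point \<open>i\<close> and 0 on the
  complement \<open>J\<close>; its values elsewhere in \<open>I\<close> do not matter, since one
  vanishing factor 1 - p i suffices to make \<open>q\<close> equal to 1. Denominators compare only
  points with different limits, so their inverses converge.\<close>

lemma mp_indicator:
  assumes "I \<subseteq> {..<r}" "\<And>i j. i \<in> I \<Longrightarrow> j \<in> {..<r} - I \<Longrightarrow> \<exists>b<n. w0 i b \<noteq> w0 j b"
  shows "\<exists>N q. mp q \<and> (\<forall>m\<ge>N. \<forall>k<r. q m k = (if k \<in> I then 1 else 0))"
proof -
  define J where "J = {..<r} - I"
  have fin: "finite I" "finite J" using assms(1) finite_subset by (auto simp: J_def)
  obtain b where b: "\<And>i j. i \<in> I \<Longrightarrow> j \<in> J \<Longrightarrow> b i j < n \<and> w0 i (b i j) \<noteq> w0 j (b i j)"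
    using assms(2) unfolding J_def by metis
  have lim: "(\<lambda>m. w i m (b i j) - w j m (b i j)) \<longlonglongrightarrow> w0 i (b i j) - w0 j (b i j)"
    if "i \<in> I" "j \<in> J" for i j
    using that b assms(1) by (intro tendsto_intros w_lim) (auto simp: J_def)
  have "eventually (\<lambda>m. \<forall>i\<in>I. \<forall>j\<in>J. w i m (b i j) - w j m (b i j) \<noteq> 0) sequentially"
    using fin lim b by (intro eventually_ball_finite ballI tendsto_imp_eventually_ne) fastforce+
  then obtain N where N: "\<And>m i j. m \<ge> N \<Longrightarrow> i \<in> I \<Longrightarrow> j \<in> J \<Longrightarrow> w i m (b i j) - w j m (b i j) \<noteq> 0"
    unfolding eventually_sequentially by blast
  define p where "p i m k = (\<Prod>j\<in>J. (w k m (b i j) - w j m (b i j)) *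
      inverse (w i m (b i j) - w j m (b i j)))" for i m k
  define q where "q m k = 1 - (\<Prod>i\<in>I. 1 - p i m k)" for m k
  have "mp (p i)" if "i \<in> I" for i
  proof -
    have "convergent (\<lambda>m. inverse (w i m (b i j) - w j m (b i j)))" if "j \<in> J" for j
      using tendsto_inverse[OF lim[OF \<open>i \<in> I\<close> that]] b[OF \<open>i \<in> I\<close> that] convergentI by fastforce
    then show ?thesis unfolding p_def using that b
      by (intro mp_prod mp_mult mp_diff mp_var mp_const convergent_w) (auto simp: J_def)
  qed
  then have "mp q" unfolding q_def by (intro mp_diff mp_prod mp_const convergent_const) auto
  moreover have "q m k = (if k \<in> I then 1 else 0)" if "m \<ge> N" "k < r" for m k
  proof (cases "k \<in> I")
    case True
    have "p k m k = 1" unfolding p_def using N[OF that(1) True] by (intro prod.neutral) auto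
    then have "(\<Prod>i\<in>I. 1 - p i m k) = 0" using True fin by (auto intro: prod_zero)
    then show ?thesis using True by (simp add: q_def)
  next
    case False
    then have "k \<in> J" using that by (simp add: J_def)
    then have "p i m k = 0" for i unfolding p_def using fin by (auto intro!: prod_zero)
    then show ?thesis using False by (simp add: q_def)
  qed
  ultimately show ?thesis by blast
qed

lemma convergent_cluster:
  assumes "I \<subseteq> {..<r}" "\<And>i j. i \<in> I \<Longrightarrow> j \<in> {..<r} - I \<Longrightarrow> \<exists>b<n. w0 i b \<noteq> w0 j b" "mp h"
  shows "convergent (\<lambda>m. \<Sum>k\<in>I. lam m k * h m k)"
proof -
  obtain N q where q: "mp q" "\<And>m k. m \<ge> N \<Longrightarrow> k < r \<Longrightarrow> q m k = (if k \<in> I then 1 else 0)"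
    using mp_indicator[OF assms(1,2)] by blast
  have "(\<Sum>k<r. lam m k * (q m k * h m k)) = (\<Sum>k\<in>I. lam m k * h m k)" if "m \<ge> N" for m
  proof -
    have "(\<Sum>k<r. lam m k * (q m k * h m k)) = (\<Sum>k<r. if k \<in> I then lam m k * h m k else 0)"
      using q(2)[OF that] by (intro sum.cong) auto
    also have "\<dots> = (\<Sum>k\<in>{..<r} \<inter> I. lam m k * h m k)" by (simp add: sum.inter_restrict)
    finally show ?thesis using assms(1) by (simp add: Int_absorb1)
  qed
  then have "eventually (\<lambda>m. (\<Sum>k<r. lam m k * (q m k * h m k)) = (\<Sum>k\<in>I. lam m k * h m k)) sequentially"
    unfolding eventually_sequentially by blast
  then show ?thesis
    using convergent_mp[OF mp_mult[OF q(1) assms(3)]] by (simp add: convergent_cong)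
qed

end

subsection \<open>Clusters of points with the same limit\<close>

lemma power_sum_compose:
  assumes "power_sum s e R H"
  shows "power_sum n e R (\<lambda>x. H (\<lambda>l. lin_form n (\<phi> l) x))"
proof -
  obtain a where a: "H = (\<lambda>x. \<Sum>k<R. lin_form s (a k) x ^ e)"
    using assms unfolding power_sum_def by blast
  have "lin_form s b (\<lambda>l. lin_form n (\<phi> l) x) = lin_form n (\<lambda>i. \<Sum>l<s. b l * \<phi> l i) x" for b x
    unfolding lin_form_sum by (simp add: lin_form_def)
  then show ?thesis unfolding power_sum_def a
    by (intro exI[of _ "\<lambda>k i. \<Sum>l<s. a k l * \<phi> l i"]) simp
qed

lemma prod_if_less:
  fixes y z :: "'a :: comm_monoid_mult"
  assumes "a \<le> N"
  shows "(\<Prod>j<N. if j < a then y else z) = y ^ a * z ^ (N - a)"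
  using assms
proof (induction N)
  case (Suc N)
  show ?case
  proof (cases "a = Suc N")
    case True
    then have "(\<Prod>j<Suc N. if j < a then y else z) = (\<Prod>j<Suc N. y)" by (intro prod.cong) auto
    then show ?thesis using True by simp
  next
    case False
    then show ?thesis using Suc by (simp add: Suc_diff_le mult_ac)
  qed
qed simp

context convergent_weighted_points
begin

text \<open>Expand each power around the value \<open>L\<close> at the point \<open>i0\<close>. The
  deviations \<open>y\<close> tend to 0, the moments \<open>S\<close> converge, and those of order
  at least \<open>s\<close> tend to 0. The base point is the moving \<open>w i0 m\<close> rather
  than its limit, so that all linear forms involved vanish on the common kernel of the
  \<open>w k m\<close> with \<open>k\<close> in \<open>I\<close>.\<close>

lemma cluster_power_sum:
  assumes I: "I \<subseteq> {..<r}" "i0 \<in> I"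
    and same: "\<And>k b. k \<in> I \<Longrightarrow> b < n \<Longrightarrow> w0 k b = w0 i0 b"
    and cv: "\<And>h. mp h \<Longrightarrow> convergent (\<lambda>m. \<Sum>k\<in>I. lam m k * h m k)"
    and d: "d \<ge> 1"
  shows "\<exists>f. (\<forall>x. (\<lambda>m. \<Sum>k\<in>I. lam m k * lin_form n x (w k m) ^ d) \<longlonglongrightarrow> f x) \<and>
    power_sum n d (maxR (card I) (card I - 1) * d) f"
proof -
  define s where "s = card I"
  have fin: "finite I" using I(1) finite_subset by blast
  have s: "1 \<le> s" "s \<le> Suc d"
    using I fin r_le card_mono[OF _ I(1)] by (auto simp: s_def Suc_le_eq card_gt_0_iff)
  have i0: "i0 < r" using I by auto
  define y where "y x m k = lin_form n x (w k m) - lin_form n x (w i0 m)" for x m k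
  define L where "L x m = lin_form n x (w i0 m)" for x m
  define S where "S x a m = (\<Sum>k\<in>I. lam m k * y x m k ^ a)" for x a m
  have Llim: "L x \<longlonglongrightarrow> lin_form n x (w0 i0)" for x
    using lin_form_w_tendsto[OF i0, of x] by (simp add: L_def[abs_def])
  have mpy: "mp (y x)" for x
    using mp_diff[OF mp_lin_form[of x] mp_const[OF convergentI[OF Llim[of x]]]]
    by (simp add: y_def[abs_def] L_def)
  have ylim: "(\<lambda>m. y x m k) \<longlonglongrightarrow> 0" if "k \<in> I" for x k
  proof -
    have "lin_form n x (w0 k) = lin_form n x (w0 i0)"
      unfolding lin_form_def using same[OF that] by (intro sum.cong) auto
    moreover have "(\<lambda>m. y x m k) \<longlonglongrightarrow> lin_form n x (w0 k) - lin_form n x (w0 i0)"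
      unfolding y_def using that I i0 by (intro tendsto_diff lin_form_w_tendsto) auto
    ultimately show ?thesis by simp
  qed
  have Sconv: "convergent (S x a)" for x a
    using cv[OF mp_power[OF mpy]] by (simp add: S_def[abs_def])

  have S0: "S x a \<longlonglongrightarrow> 0" if "s \<le> a" for x a
  proof -
    define Y where "Y = y x"
    \<comment> \<open>Replacing \<open>Y\<close> by \<open>Y - Y j\<close> in one factor costs
      \<open>Y j\<close> times a convergent sum, hence a null sequence. For J = I the product
      vanishes at every point of the cluster, so the moments of order at least \<open>s\<close> are
      null.\<close>
    have null: "(\<lambda>m. \<Sum>k\<in>I. lam m k * (((\<Prod>i\<in>J. Y m k - Y m i) - Y m k ^ card J) * h m k)) \<longlonglongrightarrow> 0"
      if "finite J" "J \<subseteq> I" "mp h" for J h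
      using that
    proof (induction J arbitrary: h rule: finite_induct)
      case empty
      show ?case by simp
    next
      case (insert j J)
      have mpp: "mp (\<lambda>m k. \<Prod>i\<in>J. Y m k - Y m i)"
        using insert.prems ylim convergentI unfolding Y_def
        by (intro mp_prod mp_diff mpy mp_const) blast
      have "(\<lambda>m. (\<Sum>k\<in>I. lam m k * (((\<Prod>i\<in>J. Y m k - Y m i) - Y m k ^ card J) * (Y m k * h m k)))
          - Y m j * (\<Sum>k\<in>I. lam m k * ((\<Prod>i\<in>J. Y m k - Y m i) * h m k))) \<longlonglongrightarrow>
          0 - 0 * lim (\<lambda>m. \<Sum>k\<in>I. lam m k * ((\<Prod>i\<in>J. Y m k - Y m i) * h m k))"
      proof (intro tendsto_diff tendsto_mult)
        show "(\<lambda>m. \<Sum>k\<in>I. lam m k * (((\<Prod>i\<in>J. Y m k - Y m i) - Y m k ^ card J) * (Y m k * h m k))) \<longlonglongrightarrow> 0"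
          using insert.prems mpy by (intro insert.IH mp_mult) (auto simp: Y_def)
        show "(\<lambda>m. Y m j) \<longlonglongrightarrow> 0" using ylim insert.prems by (simp add: Y_def)
        show "(\<lambda>m. \<Sum>k\<in>I. lam m k * ((\<Prod>i\<in>J. Y m k - Y m i) * h m k)) \<longlonglongrightarrow>
            lim (\<lambda>m. \<Sum>k\<in>I. lam m k * ((\<Prod>i\<in>J. Y m k - Y m i) * h m k))"
          using cv[OF mp_mult[OF mpp insert.prems(2)]] by (simp add: convergent_LIMSEQ_iff)
      qed
      moreover have "(\<Sum>k\<in>I. lam m k * (((\<Prod>i\<in>J. Y m k - Y m i) - Y m k ^ card J) * (Y m k * h m k)))
          - Y m j * (\<Sum>k\<in>I. lam m k * ((\<Prod>i\<in>J. Y m k - Y m i) * h m k)) =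
          (\<Sum>k\<in>I. lam m k * (((\<Prod>i\<in>insert j J. Y m k - Y m i) - Y m k ^ card (insert j J)) * h m k))" for m
        unfolding sum_distrib_left sum_subtractf[symmetric] using insert.hyps
        by (intro sum.cong) (auto simp: algebra_simps)
      ultimately show ?case by simp
    qed
    have "mp (\<lambda>m k. Y m k ^ (a - s))" unfolding Y_def by (intro mp_power mpy)
    from tendsto_minus[OF null[OF fin subset_refl this]]
    have "(\<lambda>m. - (\<Sum>k\<in>I. lam m k * (((\<Prod>i\<in>I. Y m k - Y m i) - Y m k ^ card I) * Y m k ^ (a - s)))) \<longlonglongrightarrow> 0"
      by simp
    moreover have "- (\<Sum>k\<in>I. lam m k * (((\<Prod>i\<in>I. Y m k - Y m i) - Y m k ^ card I) * Y m k ^ (a - s))) = S x a m" for m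
    proof -
      have "(\<Prod>i\<in>I. Y m k - Y m i) = 0" if "k \<in> I" for k
        using that fin by (auto intro: prod_zero)
      then show ?thesis unfolding S_def sum_negf[symmetric]
        using \<open>s \<le> a\<close> by (intro sum.cong) (auto simp: Y_def s_def power_add[symmetric])
    qed
    ultimately show ?thesis by simp
  qed

  \<comment> \<open>The pair (a, k) stands for the term y^a L^(s-1-a) of point \<open>k\<close>,
    written as a product of s - 1 linear forms in x: \<open>a\<close> differences from the base
    point, then copies of the base point. The binomial coefficient goes into
    \<open>lam'\<close>.\<close>
  define u where "u m p j = (if j < fst p then (\<lambda>b. w (snd p) m b - w i0 m b) else w i0 m)"
    for m j :: nat and p :: "nat \<times> nat"
  define lam' where "lam' m p = of_nat (d choose fst p) * lam m (snd p)" for m and p :: "nat \<times> nat"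
  define A where "A = {..<s} \<times> I"
  define g where "g x = (\<Sum>a<s. of_nat (d choose a) * lin_form n x (w0 i0) ^ (s - 1 - a) * lim (S x a))" for x
  have g_eq: "(\<Sum>p\<in>A. lam' m p * (\<Prod>j<s - 1. lin_form n (u m p j) x)) =
      (\<Sum>a<s. of_nat (d choose a) * L x m ^ (s - 1 - a) * S x a m)" for m x
  proof -
    have *: "(\<Prod>j<s - 1. lin_form n (u m (a, k) j) x) = y x m k ^ a * L x m ^ (s - 1 - a)"
      if "a < s" for a k
    proof -
      have "(\<Prod>j<s - 1. lin_form n (u m (a, k) j) x) = (\<Prod>j<s - 1. if j < a then y x m k else L x m)"
        by (intro prod.cong) (auto simp: u_def y_def L_def lin_form_diff lin_form_commute[of n x])
      then show ?thesis using that by (simp add: prod_if_less)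
    qed
    have "(\<Sum>p\<in>A. lam' m p * (\<Prod>j<s - 1. lin_form n (u m p j) x)) =
        (\<Sum>a<s. \<Sum>k\<in>I. lam' m (a, k) * (\<Prod>j<s - 1. lin_form n (u m (a, k) j) x))"
      unfolding A_def by (simp add: sum.cartesian_product)
    also have "\<dots> = (\<Sum>a<s. of_nat (d choose a) * L x m ^ (s - 1 - a) * S x a m)"
      unfolding S_def sum_distrib_left
      by (intro sum.cong refl) (auto simp: *[simplified] lam'_def mult_ac)
    finally show ?thesis .
  qed
  have g_lim: "(\<lambda>m. \<Sum>a<s. of_nat (d choose a) * L x m ^ (s - 1 - a) * S x a m) \<longlonglongrightarrow> g x" for x
    unfolding g_def using Sconv by (intro tendsto_intros Llim) (simp add: convergent_LIMSEQ_iff)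

  define f where "f x = lin_form n x (w0 i0) ^ (Suc d - s) * g x" for x
  have f_lim: "(\<lambda>m. \<Sum>k\<in>I. lam m k * lin_form n x (w k m) ^ d) \<longlonglongrightarrow> f x" for x
  proof -
    have "(\<Sum>k\<in>I. lam m k * lin_form n x (w k m) ^ d) =
        L x m ^ (Suc d - s) * (\<Sum>a<s. of_nat (d choose a) * L x m ^ (s - 1 - a) * S x a m) +
        (\<Sum>a=s..d. of_nat (d choose a) * L x m ^ (d - a) * S x a m)" for m
    proof -
      have "(\<Sum>k\<in>I. lam m k * lin_form n x (w k m) ^ d) = (\<Sum>k\<in>I. lam m k * (y x m k + L x m) ^ d)"
        by (simp add: y_def L_def)
      also have "\<dots> = (\<Sum>a\<le>d. of_nat (d choose a) * L x m ^ (d - a) * S x a m)"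
        unfolding S_def binomial_ring sum_distrib_left by (subst sum.swap) (simp add: mult_ac)
      \<comment> \<open>The orders below \<open>s\<close> share the factor L^(d-s+1); the remaining
        ones vanish in the limit by \<open>S0\<close>.\<close>
      also have "{..d} = {..<s} \<union> {s..d}" using s by auto
      also have "(\<Sum>a\<in>{..<s} \<union> {s..d}. of_nat (d choose a) * L x m ^ (d - a) * S x a m) =
          (\<Sum>a<s. of_nat (d choose a) * L x m ^ (d - a) * S x a m) +
          (\<Sum>a=s..d. of_nat (d choose a) * L x m ^ (d - a) * S x a m)"
        by (intro sum.union_disjoint) auto
      also have "(\<Sum>a<s. of_nat (d choose a) * L x m ^ (d - a) * S x a m) =
          L x m ^ (Suc d - s) * (\<Sum>a<s. of_nat (d choose a) * L x m ^ (s - 1 - a) * S x a m)"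
        unfolding sum_distrib_left
      proof (intro sum.cong refl)
        fix a assume "a \<in> {..<s}"
        then have "d - a = (Suc d - s) + (s - 1 - a)" using s by auto
        then show "of_nat (d choose a) * L x m ^ (d - a) * S x a m =
            L x m ^ (Suc d - s) * (of_nat (d choose a) * L x m ^ (s - 1 - a) * S x a m)"
          by (simp only: power_add mult_ac)
      qed
      finally show ?thesis .
    qed
    moreover have "(\<lambda>m. L x m ^ (Suc d - s) * (\<Sum>a<s. of_nat (d choose a) * L x m ^ (s - 1 - a) * S x a m) +
        (\<Sum>a=s..d. of_nat (d choose a) * L x m ^ (d - a) * S x a m)) \<longlonglongrightarrow>
        lin_form n x (w0 i0) ^ (Suc d - s) * g x +
        (\<Sum>a=s..d. of_nat (d choose a) * lin_form n x (w0 i0) ^ (d - a) * 0)"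
      by (intro tendsto_intros Llim g_lim S0) auto
    ultimately show ?thesis by (simp add: f_def)
  qed

  have "power_sum n d (maxR s (s - 1) * d) f"
  proof (cases "s = 1")
    \<comment> \<open>Here \<open>g\<close> is a constant, and the convention
      \<open>maxR n 0 = 1\<close> matches the single power.\<close>
    case True
    have "f = (\<lambda>x. lim (\<lambda>m. \<Sum>k\<in>I. lam m k) * lin_form n (w0 i0) x ^ d)"
      by (rule ext) (simp add: f_def g_def True S_def[abs_def] lin_form_commute[of n _ "w0 i0"] mult.commute)
    then have "power_sum n d 1 f" using power_sum_cmult[OF power_sum_power d] by simp
    then show ?thesis by (rule power_sum_mono) (use d True in \<open>auto simp: maxR_def\<close>)
  next
    case False
    have "\<exists>\<phi> H. hom_form s (s - 1) H \<and> g = (\<lambda>x. H (\<lambda>l. lin_form n (\<phi> l) x))"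
    proof (rule limit_power_sums_essential_variables[where I = I and A = A and lam = lam' and u = u and w = w])
      show "finite I" "card I = s" "finite A" using fin by (auto simp: s_def A_def)
      show "(\<lambda>m. \<Sum>p\<in>A. lam' m p * (\<Prod>j<s - 1. lin_form n (u m p j) x)) \<longlonglongrightarrow> g x" for x
        unfolding g_eq by (rule g_lim)
      show "lin_form n (u m p j) z = 0"
        if "\<And>k. k \<in> I \<Longrightarrow> lin_form n z (w k m) = 0" "p \<in> A" for m z p j
        using that I by (auto simp: u_def A_def lin_form_diff lin_form_commute[of n z])
      fix i :: "nat \<Rightarrow> nat" assume i: "\<And>j. j < s - 1 \<Longrightarrow> i j < n"
      have "convergent (\<lambda>m. \<Sum>a<s. of_nat (d choose a) *
          (\<Sum>k\<in>I. lam m k * (\<Prod>j<s - 1. if j < a then w k m (i j) - w i0 m (i j) else w i0 m (i j))))"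
      proof (rule convergent_sum, rule convergent_mult[OF convergent_const], rule cv, rule mp_prod)
        fix a j assume "j \<in> {..<s - 1}"
        then have "i j < n" using i by auto
        then show "mp (\<lambda>m k. if j < a then w k m (i j) - w i0 m (i j) else w i0 m (i j))"
          by (cases "j < a") (auto intro!: mp_diff mp_var mp_const convergent_w i0)
      qed
      moreover have "(\<Sum>a<s. of_nat (d choose a) *
          (\<Sum>k\<in>I. lam m k * (\<Prod>j<s - 1. if j < a then w k m (i j) - w i0 m (i j) else w i0 m (i j)))) =
          (\<Sum>p\<in>A. lam' m p * (\<Prod>j<s - 1. u m p j (i j)))" for m
      proof -
        have "(\<Sum>p\<in>A. lam' m p * (\<Prod>j<s - 1. u m p j (i j))) =
            (\<Sum>a<s. \<Sum>k\<in>I. lam' m (a, k) * (\<Prod>j<s - 1. u m (a, k) j (i j)))"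
          unfolding A_def by (simp add: sum.cartesian_product)
        then show ?thesis unfolding sum_distrib_left
          by (simp add: lam'_def u_def mult.assoc if_distrib[of "\<lambda>f. f _"] cong: if_cong)
      qed
      ultimately show "convergent (\<lambda>m. \<Sum>p\<in>A. lam' m p * (\<Prod>j<s - 1. u m p j (i j)))" by simp
    qed
    then obtain \<phi> H where H: "hom_form s (s - 1) H" "g = (\<lambda>x. H (\<lambda>l. lin_form n (\<phi> l) x))" by blast
    have "power_sum n (s - 1) (maxR s (s - 1)) g"
      unfolding H(2) using False s by (intro power_sum_compose[OF power_sum_maxR[OF H(1)]]) simp
    then obtain b where b: "g = (\<lambda>x. \<Sum>k<maxR s (s - 1). lin_form n (b k) x ^ (s - 1))"
      unfolding power_sum_def by blast
    \<comment> \<open>Each summand is a binary monomial of degree (d - s + 1) + (s - 1) = d, hence a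
      sum of \<open>d\<close> powers.\<close>
    have "f = (\<lambda>x. \<Sum>k<maxR s (s - 1). lin_form n (w0 i0) x ^ (Suc d - s) * lin_form n (b k) x ^ (s - 1))"
      by (rule ext) (simp add: f_def b sum_distrib_left lin_form_commute[of n _ "w0 i0"])
    moreover have "power_sum n d (\<Sum>k<maxR s (s - 1). d) \<dots>"
      using s d by (intro power_sum_sum power_sum_binary_monomial) auto
    ultimately show ?thesis by simp
  qed
  then show ?thesis using f_lim unfolding s_def by blast
qed

text \<open>The fibres of the map from points to limits have sizes adding up to \<open>r\<close>, so
  the cluster bounds add up to at most \<open>partM r\<close>.\<close>

lemma power_sum_partM:
  assumes "d \<ge> 1" and f: "\<And>x. (\<lambda>m. \<Sum>k<r. lam m k * lin_form n x (w k m) ^ d) \<longlonglongrightarrow> f x"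
  shows "power_sum n d (partM r * d) f"
proof -
  \<comment> \<open>Restriction makes equality of limits depend on the coordinates below
    \<open>n\<close> only.\<close>
  define \<kappa> where "\<kappa> k = restrict (w0 k) {..<n}" for k
  define cl where "cl c = {k \<in> {..<r}. \<kappa> k = c}" for c
  define C where "C = \<kappa> ` {..<r}"
  have \<kappa>: "\<kappa> k = \<kappa> j \<longleftrightarrow> (\<forall>b<n. w0 k b = w0 j b)" for k j
    by (auto simp: \<kappa>_def restrict_def fun_eq_iff)
  have "\<exists>F. (\<forall>x. (\<lambda>m. \<Sum>k\<in>cl c. lam m k * lin_form n x (w k m) ^ d) \<longlonglongrightarrow> F x) \<and>
      power_sum n d (maxR (card (cl c)) (card (cl c) - 1) * d) F" if c: "c \<in> C" for c
  proof -
    obtain i0 where i0: "i0 < r" "c = \<kappa> i0" using c by (auto simp: C_def)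
    show ?thesis
    proof (rule cluster_power_sum)
      show "cl c \<subseteq> {..<r}" "i0 \<in> cl c" using i0 by (auto simp: cl_def)
      show "w0 k b = w0 i0 b" if "k \<in> cl c" "b < n" for k b
        using that i0 \<kappa> by (auto simp: cl_def)
      show "convergent (\<lambda>m. \<Sum>k\<in>cl c. lam m k * h m k)" if "mp h" for h
      proof (rule convergent_cluster[OF _ _ that])
        show "cl c \<subseteq> {..<r}" by (auto simp: cl_def)
        fix i j assume "i \<in> cl c" "j \<in> {..<r} - cl c"
        then have "\<kappa> i \<noteq> \<kappa> j" by (auto simp: cl_def)
        then show "\<exists>b<n. w0 i b \<noteq> w0 j b" unfolding \<kappa> by blast
      qed
    qed (rule assms(1))
  qed
  then have "\<exists>F. \<forall>c\<in>C. (\<forall>x. (\<lambda>m. \<Sum>k\<in>cl c. lam m k * lin_form n x (w k m) ^ d) \<longlonglongrightarrow> F c x) \<and>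
      power_sum n d (maxR (card (cl c)) (card (cl c) - 1) * d) (F c)"
    by (intro bchoice ballI)
  then obtain F where F:
    "\<And>c x. c \<in> C \<Longrightarrow> (\<lambda>m. \<Sum>k\<in>cl c. lam m k * lin_form n x (w k m) ^ d) \<longlonglongrightarrow> F c x"
    "\<And>c. c \<in> C \<Longrightarrow> power_sum n d (maxR (card (cl c)) (card (cl c) - 1) * d) (F c)"
    by blast
  have group: "(\<Sum>k<r. h k) = (\<Sum>c\<in>C. \<Sum>k\<in>cl c. h k)" for h :: "nat \<Rightarrow> 'z::comm_monoid_add"
    unfolding C_def cl_def by (rule sum.image_gen) simp
  have "f x = (\<Sum>c\<in>C. F c x)" for x
  proof (rule LIMSEQ_unique[OF f])
    show "(\<lambda>m. \<Sum>k<r. lam m k * lin_form n x (w k m) ^ d) \<longlonglongrightarrow> (\<Sum>c\<in>C. F c x)"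
      unfolding group by (intro tendsto_sum F(1))
  qed
  then have "f = (\<lambda>x. \<Sum>c\<in>C. F c x)" by blast
  moreover have "power_sum n d (\<Sum>c\<in>C. maxR (card (cl c)) (card (cl c) - 1) * d) \<dots>"
    by (intro power_sum_sum F(2)) (auto simp: C_def)
  ultimately have "power_sum n d (\<Sum>c\<in>C. maxR (card (cl c)) (card (cl c) - 1) * d) f" by simp
  moreover have "(\<Sum>c\<in>C. maxR (card (cl c)) (card (cl c) - 1)) \<le> partM r"
  proof (rule partM_ge_partition)
    show "finite C" by (simp add: C_def)
    show "1 \<le> card (cl c)" if "c \<in> C" for c
      using that by (auto simp: C_def cl_def Suc_le_eq card_gt_0_iff)
    show "(\<Sum>c\<in>C. card (cl c)) = r" using group[of "\<lambda>_. 1::nat"] by simp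
  qed
  then have "(\<Sum>c\<in>C. maxR (card (cl c)) (card (cl c) - 1) * d) \<le> partM r * d"
    by (simp add: sum_distrib_right[symmetric])
  ultimately show ?thesis using assms(1) by (rule power_sum_mono)
qed

end

subsection \<open>Limits of power sums\<close>

text \<open>Take \<open>t\<close> on the moment curve (1, z, z^2, ...): each nonzero vector gives a
  nonzero polynomial in z, and some z avoids the finitely many roots.\<close>

lemma generic_lin_form_exists:
  fixes u :: "nat \<Rightarrow> nat \<Rightarrow> complex"
  assumes "\<And>k. k < r \<Longrightarrow> \<exists>i<n. u k i \<noteq> 0"
  shows "\<exists>t. \<forall>k<r. lin_form n t (u k) \<noteq> 0"
proof -
  define p where "p k = (\<Sum>i<n. monom (u k i) i)" for k
  have "p k \<noteq> 0" if k: "k < r" for k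
  proof -
    obtain i where "i < n" "u k i \<noteq> 0" using assms k by blast
    then have "coeff (p k) i \<noteq> 0"
      by (simp add: p_def coeff_sum)
    then show ?thesis by auto
  qed
  then have "finite (\<Union>k<r. {z. poly (p k) z = 0})" by (auto intro: poly_roots_finite)
  then obtain z where z: "z \<notin> (\<Union>k<r. {z. poly (p k) z = 0})"
    using ex_new_if_finite[OF infinite_UNIV_char_0] by metis
  have "lin_form n (\<lambda>i. z ^ i) (u k) = poly (p k) z" for k
    by (simp add: lin_form_def p_def poly_sum poly_monom mult.commute)
  then show ?thesis using z by (intro exI[of _ "\<lambda>i. z ^ i"]) auto
qed

text \<open>By the symmetry of \<open>lin_form\<close> in its two vectors, a product of forms
  \<open>bs\<close> evaluated at \<open>v m k\<close> is a fixed sum of d-th powers of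
  \<open>v m k\<close> evaluated at points \<open>a j\<close>.\<close>

lemma convergent_polarization:
  fixes v :: "nat \<Rightarrow> nat \<Rightarrow> nat \<Rightarrow> complex"
  assumes "\<And>x. convergent (\<lambda>m. \<Sum>k<r. lin_form n (v m k) x ^ d)" "length bs = d"
  shows "convergent (\<lambda>m. \<Sum>k<r. prod_list (map (\<lambda>b. lin_form n b (v m k)) bs))"
proof -
  obtain a where "(\<lambda>x. prod_list (map (\<lambda>u. lin_form n u x) bs)) =
      (\<lambda>x. \<Sum>j<fact d :: nat. lin_form n (a j) x ^ d)"
    using power_sum_prod_list[of n bs] assms(2) unfolding power_sum_def by blast
  then have a: "prod_list (map (\<lambda>u. lin_form n u x) bs) = (\<Sum>j<fact d :: nat. lin_form n (a j) x ^ d)" for x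
    by meson
  have "convergent (\<lambda>m. \<Sum>j<fact d :: nat. \<Sum>k<r. lin_form n (v m k) (a j) ^ d)"
    by (intro convergent_sum assms(1))
  then show ?thesis unfolding a
    by (subst sum.swap) (simp add: lin_form_commute[of n "v _ _"])
qed

lemma power_sum_limit_low_degree:
  fixes v :: "nat \<Rightarrow> nat \<Rightarrow> nat \<Rightarrow> complex"
  assumes lim: "\<And>x. (\<lambda>m. \<Sum>k<r. lin_form n (v m k) x ^ d) \<longlonglongrightarrow> f x"
    and d: "1 \<le> d" "d < r"
  shows "power_sum n d (partM r * d) f"
proof -
  have "\<exists>\<phi> H. hom_form r d H \<and> f = (\<lambda>x. H (\<lambda>l. lin_form n (\<phi> l) x))"
  proof (rule limit_power_sums_essential_variables[where I = "{..<r}" and A = "{..<r}"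
        and lam = "\<lambda>_ _. 1" and u = "\<lambda>m k j. v m k" and w = "\<lambda>k m. v m k"])
    show "(\<lambda>m. \<Sum>k<r. 1 * (\<Prod>j<d. lin_form n (v m k) x)) \<longlonglongrightarrow> f x" for x
      using lim[of x] by simp
    fix i :: "nat \<Rightarrow> nat" assume i: "\<And>j. j < d \<Longrightarrow> i j < n"
    define bs where "bs = map (\<lambda>j b. if b = i j then 1 else (0::complex)) [0..<d]"
    have prod: "prod_list (map (\<lambda>b. lin_form n b x) bs) = (\<Prod>j<d. x (i j))" for x
    proof -
      have "map (\<lambda>b. lin_form n b x) bs = map (\<lambda>j. x (i j)) [0..<d]"
        unfolding bs_def using i by (auto intro!: lin_form_unit)
      then show ?thesis by (simp add: prod.distinct_set_conv_list[symmetric] atLeast0LessThan)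
    qed
    have "length bs = d" by (simp add: bs_def)
    from convergent_polarization[OF convergentI[OF lim] this]
    show "convergent (\<lambda>m. \<Sum>k<r. 1 * (\<Prod>j<d. v m k (i j)))" by (simp add: prod)
  qed (auto simp: lin_form_commute)
  then obtain \<phi> H where H: "hom_form r d H" "f = (\<lambda>x. H (\<lambda>l. lin_form n (\<phi> l) x))" by blast
  have "power_sum n d (maxR r d) f"
    unfolding H(2) by (rule power_sum_compose[OF power_sum_maxR[OF H(1) d(1)]])
  moreover have "maxR r d \<le> partM r * d"
  proof -
    have "maxR r d \<le> maxR r (r - 1)" using d by (intro maxR_mono_degree) auto
    \<comment> \<open>The partition of \<open>r\<close> into a single part.\<close>
    also have "\<dots> \<le> partM r" using partM_ge[of 1 "\<lambda>_. r" r] d by simp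
    also have "\<dots> \<le> partM r * d" using d by simp
    finally show ?thesis .
  qed
  ultimately show ?thesis using d(1) by (rule power_sum_mono)
qed

text \<open>Reduction to the locale: normalize each form, pass to a subsequence along which
  directions converge to nonzero vectors, choose a chart \<open>t\<close> containing all limits, and
  collect the scalars in weights \<open>mu m k ^ d\<close>.\<close>

lemma power_sum_limit_high_degree:
  fixes v :: "nat \<Rightarrow> nat \<Rightarrow> nat \<Rightarrow> complex"
  assumes lim: "\<And>x. (\<lambda>m. \<Sum>k<r. lin_form n (v m k) x ^ d) \<longlonglongrightarrow> f x"
    and d: "1 \<le> d" "r \<le> Suc d" and n: "n \<ge> 1"
  shows "power_sum n d (partM r * d) f"
proof -
  define N where "N m k = (\<Sum>i<n. norm (v m k i))" for m k
  \<comment> \<open>A zero form gets the first unit vector as direction, with scale 0, so that every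
    direction has norm 1; this needs \<open>n \<ge> 1\<close>.\<close>
  define u where "u m k i = (if N m k = 0 then (if i = 0 then 1 else 0) else v m k i / of_real (N m k))"
    for m k i
  have v: "v m k i = of_real (N m k) * u m k i" if "i < n" for m k i
  proof (cases "N m k = 0")
    case True
    then have "\<forall>i\<in>{..<n}. norm (v m k i) = 0"
      unfolding N_def by (subst (asm) sum_nonneg_eq_0_iff) auto
    then show ?thesis using True that by simp
  qed (simp add: u_def)
  have u1: "(\<Sum>i<n. norm (u m k i)) = 1" for m k
  proof (cases "N m k = 0")
    case True
    then have "(\<Sum>i<n. norm (u m k i)) = (\<Sum>i<n. if i = 0 then 1 else 0)"
      by (intro sum.cong) (auto simp: u_def)
    then show ?thesis using n by simp
  next
    case False
    have "N m k \<ge> 0" unfolding N_def by (intro sum_nonneg) auto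
    with False show ?thesis
      by (simp add: u_def norm_divide sum_divide_distrib[symmetric] N_def[symmetric])
  qed
  have "norm (u m k i) \<le> 1" if "i < n" for m k i
    using member_le_sum[of i "{..<n}" "\<lambda>i. norm (u m k i)"] u1[of m k] that by auto
  then obtain \<rho> :: "nat \<Rightarrow> nat" where \<rho>: "strict_mono \<rho>"
      "\<forall>(k, i)\<in>{..<r} \<times> {..<n}. convergent (\<lambda>m. u (\<rho> m) k i)"
    using convergent_subseq_finite[of "{..<r} \<times> {..<n}" "\<lambda>(k, i) m. u m k i"]
    by (auto simp: split_def)
  define u0 where "u0 k i = lim (\<lambda>m. u (\<rho> m) k i)" for k i
  have u0: "(\<lambda>m. u (\<rho> m) k i) \<longlonglongrightarrow> u0 k i" if "k < r" "i < n" for k i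
    using \<rho>(2) that unfolding u0_def by (auto simp: convergent_LIMSEQ_iff[symmetric])
  have "\<exists>i<n. u0 k i \<noteq> 0" if "k < r" for k
  proof -
    have "(\<lambda>m. \<Sum>i<n. norm (u (\<rho> m) k i)) \<longlonglongrightarrow> (\<Sum>i<n. norm (u0 k i))"
      using that by (intro tendsto_intros u0) auto
    then have "(\<Sum>i<n. norm (u0 k i)) = 1" by (simp add: u1 LIMSEQ_const_iff)
    then show ?thesis by (metis (no_types, lifting) lessThan_iff norm_zero sum.neutral zero_neq_one)
  qed
  then obtain t where t: "\<And>k. k < r \<Longrightarrow> lin_form n t (u0 k) \<noteq> 0"
    using generic_lin_form_exists[of r n u0] by blast
  have tlim: "(\<lambda>m. lin_form n t (u (\<rho> m) k)) \<longlonglongrightarrow> lin_form n t (u0 k)" if "k < r" for k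
    unfolding lin_form_def using that by (intro tendsto_intros u0) auto
  have "eventually (\<lambda>m. \<forall>k\<in>{..<r}. lin_form n t (u (\<rho> m) k) \<noteq> 0) sequentially"
    by (intro eventually_ball_finite ballI tendsto_imp_eventually_ne[OF tlim]) (auto simp: t)
  then obtain M where M: "\<And>m k. m \<ge> M \<Longrightarrow> k < r \<Longrightarrow> lin_form n t (u (\<rho> m) k) \<noteq> 0"
    unfolding eventually_sequentially by auto
  \<comment> \<open>Dropping the first \<open>M\<close> terms puts every point, not just those for
    large \<open>m\<close>, in the chart.\<close>
  define \<sigma> where "\<sigma> m = \<rho> (m + M)" for m
  have \<sigma>: "strict_mono \<sigma>" using \<rho>(1) by (auto simp: \<sigma>_def strict_mono_def)
  define T where "T m k = lin_form n t (u (\<sigma> m) k)" for m k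
  have T: "T m k \<noteq> 0" if "k < r" for m k using M[of "m + M" k] that by (simp add: T_def \<sigma>_def)
  define w where "w k m i = inverse (T m k) * u (\<sigma> m) k i" for k m i
  define w0 where "w0 k i = inverse (lin_form n t (u0 k)) * u0 k i" for k i
  define mu where "mu m k = of_real (N (\<sigma> m) k) * T m k" for m k
  have vw: "lin_form n b (v (\<sigma> m) k) = mu m k * lin_form n b (w k m)" if "k < r" for b m k
    unfolding lin_form_def sum_distrib_left
    using T[OF that] by (intro sum.cong) (auto simp: v w_def mu_def)
  have prodvw: "prod_list (map (\<lambda>b. lin_form n b (v (\<sigma> m) k)) bs) =
      mu m k ^ length bs * prod_list (map (\<lambda>b. lin_form n b (w k m)) bs)" if "k < r" for m k bs
    by (induction bs) (simp_all add: vw[OF that] mult_ac)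
  interpret convergent_weighted_points n d r w w0 "\<lambda>m k. mu m k ^ d" t
  proof
    fix k i assume ki: "k < r" "i < n"
    have "(\<lambda>m. T m k) \<longlonglongrightarrow> lin_form n t (u0 k)"
      using LIMSEQ_ignore_initial_segment[OF tlim[OF ki(1)], of M] by (simp add: T_def \<sigma>_def)
    moreover have "(\<lambda>m. u (\<sigma> m) k i) \<longlonglongrightarrow> u0 k i"
      using LIMSEQ_ignore_initial_segment[OF u0[OF ki], of M] by (simp add: \<sigma>_def)
    ultimately show "(\<lambda>m. w k m i) \<longlonglongrightarrow> w0 k i"
      unfolding w_def w0_def using t[OF ki(1)] by (intro tendsto_intros)
  next
    fix k m assume "k < r"
    then show "lin_form n t (w k m) = 1"
      using T[of k m] unfolding w_def
      by (simp add: lin_form_commute[of n t] lin_form_cmult) (simp add: lin_form_commute[of n _ t] T_def)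
  next
    fix bs :: "(nat \<Rightarrow> complex) list" assume "length bs = d"
    then have "convergent (\<lambda>m. \<Sum>k<r. prod_list (map (\<lambda>b. lin_form n b (v m k)) bs))"
      using convergent_polarization convergentI[OF lim] by blast
    from convergent_subseq_convergent[OF this \<sigma>]
    show "convergent (\<lambda>m. \<Sum>k<r. mu m k ^ d * prod_list (map (\<lambda>b. lin_form n b (w k m)) bs))"
      using \<open>length bs = d\<close> by (simp add: o_def prodvw)
  qed (rule d(2))
  show ?thesis
  proof (rule power_sum_partM[OF d(1)])
    fix x
    have "(\<lambda>m. \<Sum>k<r. lin_form n (v (\<sigma> m) k) x ^ d) \<longlonglongrightarrow> f x"
      using LIMSEQ_subseq_LIMSEQ[OF lim \<sigma>] by (simp add: o_def)
    then show "(\<lambda>m. \<Sum>k<r. mu m k ^ d * lin_form n x (w k m) ^ d) \<longlonglongrightarrow> f x"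
      by (simp add: lin_form_commute[of n _ x] vw power_mult_distrib)
  qed
qed

lemma power_sum_limit:
  fixes v :: "nat \<Rightarrow> nat \<Rightarrow> nat \<Rightarrow> complex"
  assumes lim: "\<And>x. (\<lambda>m. \<Sum>k<r. lin_form n (v m k) x ^ d) \<longlonglongrightarrow> f x" and d: "1 \<le> d"
  shows "power_sum n d (partM r * d) f"
proof -
  consider "n = 0" | "n \<ge> 1" "r \<le> Suc d" | "d < r" by linarith
  then show ?thesis
  proof cases
    case 1
    \<comment> \<open>Without variables there is no direction to normalize, but all forms are
      zero.\<close>
    have "f x = 0" for x
      using lim[of x] d by (simp add: lin_form_def 1 power_0_left LIMSEQ_const_iff)
    then have "power_sum n d 0 f" using power_sum_zero[of n d] by presburger
    then show ?thesis using d by (auto intro: power_sum_mono)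
  qed (use assms power_sum_limit_high_degree power_sum_limit_low_degree in blast)+
qed

lemma BWR_limit:
  assumes "d \<ge> 1" "hom_form n d f"
  shows "\<exists>v. \<forall>x. (\<lambda>m. \<Sum>k<BWR n d f. lin_form n (v m k) x ^ d) \<longlonglongrightarrow> f x"
proof -
  let ?S = "\<lambda>s. \<exists>P Q :: nat \<Rightarrow> nat \<Rightarrow> complex poly. (\<forall>k i. Q k i \<noteq> 0) \<and>
      (\<forall>x. ((\<lambda>\<epsilon>. \<Sum>k<s. (\<Sum>i<n. poly (P k i) \<epsilon> / poly (Q k i) \<epsilon> * x i) ^ d) \<longlongrightarrow> f x) (at 0))"
  obtain a where a: "f = (\<lambda>x. \<Sum>k<card (exps n d) * fact d. lin_form n (a k) x ^ d)"
    using power_sum_hom_form[OF assms(2,1)] unfolding power_sum_def by blast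
  \<comment> \<open>A genuine decomposition with constant coefficients shows that the
    \<open>LEAST\<close> in \<open>BWR\<close> is attained.\<close>
  have "?S (card (exps n d) * fact d)" unfolding a lin_form_def
    by (intro exI[of _ "\<lambda>k i. [:a k i:]"] exI[of _ "\<lambda>_ _. 1"]) auto
  then have "?S (BWR n d f)" unfolding BWR_def by (rule LeastI)
  then obtain P Q :: "nat \<Rightarrow> nat \<Rightarrow> complex poly" where PQ: "\<And>x. ((\<lambda>\<epsilon>. \<Sum>k<BWR n d f.
      (\<Sum>i<n. poly (P k i) \<epsilon> / poly (Q k i) \<epsilon> * x i) ^ d) \<longlongrightarrow> f x) (at 0)"
    by blast
  \<comment> \<open>The values 1/(m+1) are nonzero and tend to 0, which turns the limit at the
    punctured origin into a limit of a sequence.\<close>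
  define \<epsilon> :: "nat \<Rightarrow> complex" where "\<epsilon> m = of_real (inverse (real (Suc m)))" for m
  have "\<epsilon> \<longlonglongrightarrow> of_real 0" unfolding \<epsilon>_def[abs_def]
    by (intro tendsto_of_real LIMSEQ_inverse_real_of_nat)
  then have "filterlim \<epsilon> (at 0) sequentially"
    by (auto simp: filterlim_at \<epsilon>_def simp del: of_nat_Suc intro!: always_eventually)
  from filterlim_compose[OF PQ this] show ?thesis
    by (intro exI[of _ "\<lambda>m k i. poly (P k i) (\<epsilon> m) / poly (Q k i) (\<epsilon> m)"])
      (simp add: lin_form_def)
qed

theorem theorem13:
  fixes n d r :: nat and f :: "(nat \<Rightarrow> complex) \<Rightarrow> complex"
  assumes "d \<ge> 1"
    and "hom_form n d f"
    and "BWR n d f = r"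
  shows "WR n d f \<le> partM r * d"
proof -
  obtain v where "\<And>x. (\<lambda>m. \<Sum>k<r. lin_form n (v m k) x ^ d) \<longlonglongrightarrow> f x"
    using BWR_limit[OF assms(1,2)] assms(3) by blast
  then show ?thesis using assms(1) by (intro WR_le power_sum_limit)
qed

end
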